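(* Let $\Gamma_h=\bigcup_{E\in\mathcal{T}_h}E$ be a polygonal approximation of $\Gamma$ as in the context. Then the following hold, where in all of the inequalities $C$ depends only on the curvature of $\Gamma$. (i) For any $E\in\mathcal{T}_h$, the oriented distance function $d$ fulfills $\|d\|_{L^\infty(E)}\le Ch^2$. (ii) The quotient $\delta_h$ between the smooth and the discrete surface measures, defined by $\mathrm{d}A=\delta_h\,\mathrm{d}A_h$, satisfies $\|1-\delta_h\|_{L^\infty(\Gamma_h)}\le Ch^2$. (iii) Let $P$ and $P_h$ be the projections onto the tangent planes of the smooth and the discrete surfaces, respectively, i.e. $P_{ij}=\delta_{ij}-\nu_i\nu_j$ and $P_{h,ij}=\delta_{ij}-\nu_{h,i}\nu_{h,j}$ (with $\delta_{ij}$ the Kronecker delta), and define $$R_h=\frac{1}{\delta_h}P(I-d\mathcal{H})P_h(I-d\mathcal{H}),$$ where $\mathcal{H}$ is the Weingarten map, $\mathcal{H}_{ij}=\frac{\partial\nu_i}{\partial x_j}$. Then $\|(I-R_h)P\|_{L^\infty(\Gamma_h)}\le Ch^2$.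
   Context: Surface. $\Gamma\subset\mathbb{R}^3$ is a $\mathcal{C}^2$ surface without boundary, with unit normal field $\nu$. Fermi coordinates. $U\subset\mathbb{R}^3$ (the Fermi stripe of $\Gamma$) is an open set, associated with $\Gamma$, such that every $\mathbf{x}\in U$ admits a unique decomposition $\mathbf{x}=\mathbf{a}(\mathbf{x})+d(\mathbf{x})\nu(\mathbf{a}(\mathbf{x}))$ with $\mathbf{a}(\mathbf{x})\in\Gamma$ and $d(\mathbf{x})\in\mathbb{R}$; $d$ is the oriented distance function. The normal is extended to $U$ by $\nu(\mathbf{x}):=\nu(\mathbf{a}(\mathbf{x}))$, and $\nu$, $P$, $\mathcal{H}$, $d$ are evaluated at points $\mathbf{x}\in\Gamma_h$. Mesh. For $h>0$, $\Gamma_h=\bigcup_{E\in\mathcal{T}_h}E$, where $\mathcal{T}_h$ is a finite set of non-overlapping flat simple polygons (no holes, non-self-intersecting boundary) of diameter $h_E\le h$; $\Gamma_h\subset U$; $\mathbf{a}:\Gamma_h\to\Gamma$ is one-to-one (a bijection); the vertices (nodes) of $\Gamma_h$ lie on $\Gamma$. Nonconforming meshes are allowed (hanging nodes count as vertices). There are $\gamma_1,\gamma_2>0$ such that, for all $h$ and all $E\in\mathcal{T}_h$: (A) $E$ is star-shaped with respect to a ball of radius $\rho_E\ge\gamma_1h_E$; (B) any two distinct nodes $P,Q$ of $E$ satisfy $\|P-Q\|\ge\gamma_2h_E$. $\nu_h$ is the (elementwise constant) unit normal to $\Gamma_h$. $\mathrm{d}A$ and $\mathrm{d}A_h$ are the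 surface measures of $\Gamma$ and $\Gamma_h$; the relation $\mathrm{d}A=\delta_h\,\mathrm{d}A_h$ means that $\delta_h:\Gamma_h\to\mathbb{R}$ is the area density of the map $\mathbf{a}:\Gamma_h\to\Gamma$.
   Formalization: (ii) and (iii) are proved for h ≤ h0; for coarse meshes they fail (inscribed tetrahedra with a face near the sphere's centre). C and h0 depend on a curvature bound and on γ1, γ2 (γ1 is unavoidable). The Fermi decomposition is unique among those with |d| = dist(x,Γ). *)

theory Defs
  imports "HOL-Analysis.Analysis"
begin

definition C2_on :: "(real^3) set \<Rightarrow> (real^3 \<Rightarrow> real) \<Rightarrow> (real^3 \<Rightarrow> real^3) \<Rightarrow> bool" where
  "C2_on W f g \<longleftrightarrow>
     (\<exists>G :: real^3 \<Rightarrow> real^3^3. continuous_on W G \<and>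
        (\<forall>x\<in>W. (f has_derivative (\<lambda>v. g x \<bullet> v)) (at x) \<and>
               (g has_derivative (\<lambda>v. G x *v v)) (at x)))"

text \<open>Near each of its points the surface is a regular level set (hence it has no boundary);
  the normal field is the normalised gradient of the local defining functions. Replacing
  \<open>f\<close> by \<open>-f\<close> where necessary, every continuous unit normal field is of this form.
  The values of \<open>\<nu>\<close> outside \<open>\<Gamma>\<close> are irrelevant.\<close>

definition oriented_C2_surface :: "(real^3) set \<Rightarrow> (real^3 \<Rightarrow> real^3) \<Rightarrow> bool" where
  "oriented_C2_surface \<Gamma> \<nu> \<longleftrightarrow>
     (\<forall>p\<in>\<Gamma>. \<exists>W f g. open W \<and> p \<in> W \<and> C2_on W f g \<and> \<Gamma> \<inter> W = {x\<in>W. f x = 0} \<and>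
        (\<forall>x\<in>\<Gamma> \<inter> W. g x \<noteq> 0 \<and> \<nu> x = (1 / norm (g x)) *\<^sub>R g x))"

text \<open>The derivative of \<open>\<nu>\<close> within \<open>\<Gamma>\<close> is determined on the tangent plane only, where it is the
  Weingarten map of \<open>\<Gamma>\<close>; extending the latter by 0 in the normal direction gives an extension
  of least norm. So this says that the principal curvatures of \<open>\<Gamma>\<close> lie in \<open>[-K, K]\<close>.\<close>

definition curvature_bounded :: "(real^3) set \<Rightarrow> (real^3 \<Rightarrow> real^3) \<Rightarrow> real \<Rightarrow> bool" where
  "curvature_bounded \<Gamma> \<nu> K \<longleftrightarrow>
     (\<forall>p\<in>\<Gamma>. \<exists>S. (\<nu> has_derivative S) (at p within \<Gamma>) \<and> onorm S \<le> K)"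

text \<open>As \<open>d\<close> is the oriented distance, \<open>\<bar>d\<bar>\<close> is the distance to \<open>\<Gamma>\<close>. Without this
  requirement the decomposition would never be unique on a compact surface: a farthest point
  of \<open>\<Gamma>\<close> provides another one.\<close>

definition fermi_decomposition ::
  "(real^3) set \<Rightarrow> (real^3 \<Rightarrow> real^3) \<Rightarrow> real^3 \<Rightarrow> (real^3) \<times> real \<Rightarrow> bool" where
  "fermi_decomposition \<Gamma> \<nu> x = (\<lambda>(a, d).
     a \<in> \<Gamma> \<and> x = a + d *\<^sub>R \<nu> a \<and> \<bar>d\<bar> = infdist x \<Gamma>)"

definition fermi_stripe :: "(real^3) set \<Rightarrow> (real^3 \<Rightarrow> real^3) \<Rightarrow> (real^3) set \<Rightarrow> bool" where
  "fermi_stripe \<Gamma> \<nu> U \<longleftrightarrow> open U \<and> (\<forall>x\<in>U. \<exists>!c. fermi_decomposition \<Gamma> \<nu> x c)"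

definition fermi_proj :: "(real^3) set \<Rightarrow> (real^3 \<Rightarrow> real^3) \<Rightarrow> real^3 \<Rightarrow> real^3" where
  "fermi_proj \<Gamma> \<nu> x = fst (THE c. fermi_decomposition \<Gamma> \<nu> x c)"

definition oriented_dist :: "(real^3) set \<Rightarrow> (real^3 \<Rightarrow> real^3) \<Rightarrow> real^3 \<Rightarrow> real" where
  "oriented_dist \<Gamma> \<nu> x = snd (THE c. fermi_decomposition \<Gamma> \<nu> x c)"

definition ext_normal :: "(real^3) set \<Rightarrow> (real^3 \<Rightarrow> real^3) \<Rightarrow> real^3 \<Rightarrow> real^3" where
  "ext_normal \<Gamma> \<nu> x = \<nu> (fermi_proj \<Gamma> \<nu> x)"

definition weingarten :: "(real^3) set \<Rightarrow> (real^3 \<Rightarrow> real^3) \<Rightarrow> real^3 \<Rightarrow> real^3^3" where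
  "weingarten \<Gamma> \<nu> x = jacobian (ext_normal \<Gamma> \<nu>) (at x)"

text \<open>A polygon is given by the cyclic list of its vertices. Angles of 180 degrees are allowed,
  so that hanging nodes can be vertices.\<close>

definition poly_edge :: "(real^3) list \<Rightarrow> nat \<Rightarrow> (real^3) set" where
  "poly_edge vs i = closed_segment (vs ! i) (vs ! (Suc i mod length vs))"

definition poly_boundary :: "(real^3) list \<Rightarrow> (real^3) set" where
  "poly_boundary vs = (\<Union>i<length vs. poly_edge vs i)"

definition simple_flat_polygon :: "(real^3) list \<Rightarrow> bool" where
  "simple_flat_polygon vs \<longleftrightarrow>
     3 \<le> length vs \<and> distinct vs \<and> aff_dim (set vs) = 2 \<and>
     (\<forall>i<length vs. \<forall>j<length vs. i \<noteq> j \<longrightarrow>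
        poly_edge vs i \<inter> poly_edge vs j =
        {vs ! i, vs ! (Suc i mod length vs)} \<inter> {vs ! j, vs ! (Suc j mod length vs)})"

text \<open>The closed region: the boundary together with what it encloses in its plane.\<close>

definition poly_region :: "(real^3) list \<Rightarrow> (real^3) set" where
  "poly_region vs = poly_boundary vs \<union>
     {x \<in> affine hull set vs - poly_boundary vs.
        bounded (connected_component_set (affine hull set vs - poly_boundary vs) x)}"

definition star_shaped_wrt_disc :: "(real^3) list \<Rightarrow> real^3 \<Rightarrow> real \<Rightarrow> bool" where
  "star_shaped_wrt_disc vs c \<rho> \<longleftrightarrow>
     c \<in> affine hull set vs \<and> 0 < \<rho> \<and>
     (\<forall>y \<in> ball c \<rho> \<inter> affine hull set vs. \<forall>x \<in> poly_region vs.
        closed_segment y x \<subseteq> poly_region vs)"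

definition mesh_surface :: "(real^3) list set \<Rightarrow> (real^3) set" where
  "mesh_surface T = (\<Union>vs\<in>T. poly_region vs)"

text \<open>The fourth conjunct says that hanging nodes count as vertices.\<close>

definition polygonal_approximation ::
  "(real^3) set \<Rightarrow> (real^3 \<Rightarrow> real^3) \<Rightarrow> (real^3) set \<Rightarrow> real \<Rightarrow> real \<Rightarrow> real \<Rightarrow>
   (real^3) list set \<Rightarrow> bool" where
  "polygonal_approximation \<Gamma> \<nu> U \<gamma>1 \<gamma>2 h T \<longleftrightarrow>
     finite T \<and>
     (\<forall>vs\<in>T. simple_flat_polygon vs \<and> set vs \<subseteq> \<Gamma> \<and> diameter (poly_region vs) \<le> h) \<and>
     (\<forall>vs\<in>T. \<forall>ws\<in>T. vs \<noteq> ws \<longrightarrow>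
        rel_interior (poly_region vs) \<inter> rel_interior (poly_region ws) = {}) \<and>
     (\<forall>vs\<in>T. \<forall>ws\<in>T. set ws \<inter> poly_region vs \<subseteq> set vs) \<and>
     (\<forall>vs\<in>T. \<exists>c \<rho>. star_shaped_wrt_disc vs c \<rho> \<and> \<gamma>1 * diameter (poly_region vs) \<le> \<rho>) \<and>
     (\<forall>vs\<in>T. \<forall>p\<in>set vs. \<forall>q\<in>set vs. p \<noteq> q \<longrightarrow>
        \<gamma>2 * diameter (poly_region vs) \<le> dist p q) \<and>
     mesh_surface T \<subseteq> U \<and>
     bij_betw (fermi_proj \<Gamma> \<nu>) (mesh_surface T) \<Gamma>"

definition flat_unit_normal :: "(real^3) list \<Rightarrow> real^3 \<Rightarrow> bool" where
  "flat_unit_normal vs n \<longleftrightarrow>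
     norm n = 1 \<and> (\<forall>x\<in>affine hull set vs. \<forall>y\<in>affine hull set vs. n \<bullet> (x - y) = 0)"

definition regular_patch ::
  "(real^3) set \<Rightarrow> (real \<times> real) set \<Rightarrow> (real \<times> real \<Rightarrow> real^3) \<Rightarrow>
   (real \<times> real \<Rightarrow> real^3) \<Rightarrow> (real \<times> real \<Rightarrow> real^3) \<Rightarrow> bool" where
  "regular_patch S V \<phi> \<phi>1 \<phi>2 \<longleftrightarrow>
     open V \<and> inj_on \<phi> V \<and> \<phi> ` V \<subseteq> S \<and> continuous_on V \<phi>1 \<and> continuous_on V \<phi>2 \<and>
     (\<forall>u\<in>V. (\<phi> has_derivative (\<lambda>w. fst w *\<^sub>R \<phi>1 u + snd w *\<^sub>R \<phi>2 u)) (at u) \<and>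
            cross3 (\<phi>1 u) (\<phi>2 u) \<noteq> 0)"

text \<open>The surface measure of a surface \<open>S\<close> that is regular up to a set of area 0, as a Borel
  measure on the ambient space concentrated on \<open>S\<close>: it has the usual area element in every
  regular patch, and countably many patches exhaust it. This determines \<open>M\<close> uniquely; it is
  the two-dimensional Hausdorff measure restricted to \<open>S\<close>. Both the smooth surface and its
  polygonal approximations are covered (the edges of the latter have measure 0).\<close>

definition surface_measure :: "(real^3) set \<Rightarrow> (real^3) measure \<Rightarrow> bool" where
  "surface_measure S M \<longleftrightarrow>
     sets M = sets borel \<and>
     (\<forall>V \<phi> \<phi>1 \<phi>2 B. regular_patch S V \<phi> \<phi>1 \<phi>2 \<longrightarrow> B \<in> sets borel \<longrightarrow> B \<subseteq> V \<longrightarrow>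
        emeasure M (\<phi> ` B) = (\<integral>\<^sup>+u\<in>B. ennreal (norm (cross3 (\<phi>1 u) (\<phi>2 u))) \<partial>lborel)) \<and>
     (\<exists>V \<phi> \<phi>1 \<phi>2. (\<forall>n::nat. regular_patch S (V n) (\<phi> n) (\<phi>1 n) (\<phi>2 n)) \<and>
        UNIV - (\<Union>n. \<phi> n ` V n) \<in> null_sets M)"

text \<open>The relation \<open>dA = \<delta> dA\<^sub>h\<close>, where the map \<open>a\<close> identifies \<open>S\<close> with its image.\<close>

definition area_density ::
  "(real^3 \<Rightarrow> real^3) \<Rightarrow> (real^3) set \<Rightarrow> (real^3) measure \<Rightarrow> (real^3) measure \<Rightarrow>
   (real^3 \<Rightarrow> real) \<Rightarrow> bool" where
  "area_density a S A A\<^sub>h \<delta> \<longleftrightarrow>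
     \<delta> \<in> borel_measurable (restrict_space borel S) \<and> (\<forall>x\<in>S. 0 \<le> \<delta> x) \<and>
     (\<forall>B\<in>sets borel. B \<subseteq> S \<longrightarrow> emeasure A (a ` B) = (\<integral>\<^sup>+x\<in>B. ennreal (\<delta> x) \<partial>A\<^sub>h))"

definition tangent_proj :: "real^3 \<Rightarrow> real^3^3" where
  "tangent_proj n = (\<chi> i j. (if i = j then 1 else 0) - n $ i * n $ j)"

text \<open>\<open>n\<close> is the unit normal of the polygon containing \<open>x\<close>.\<close>

definition R_op ::
  "(real^3) set \<Rightarrow> (real^3 \<Rightarrow> real^3) \<Rightarrow> (real^3 \<Rightarrow> real) \<Rightarrow> real^3 \<Rightarrow> real^3 \<Rightarrow> real^3^3" where
  "R_op \<Gamma> \<nu> \<delta> n x =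
     (let P = tangent_proj (ext_normal \<Gamma> \<nu> x);
          P\<^sub>h = tangent_proj n;
          Q = mat 1 - oriented_dist \<Gamma> \<nu> x *\<^sub>R weingarten \<Gamma> \<nu> x
      in (1 / \<delta> x) *\<^sub>R (P ** Q ** P\<^sub>h ** Q))"

end

theory Submission
  imports Defs
begin

text \<open>
  The curvature bound makes the closest-point projection onto \<open>\<Gamma>\<close> differentiable wherever
  \<open>\<kappa> \<bar>d\<bar> \<le> 1/2\<close>: its derivative \<open>A\<close> solves \<open>A v + d P S (A v) = P v\<close>, where \<open>S\<close> is the
  derivative of the normal. Hence \<open>d\<close> has gradient \<open>\<nu>\<close>, and \<open>\<nu>\<close> is Lipschitz with constant
  \<open>2\<kappa>\<close> along segments. As \<open>d\<close> vanishes at the vertices, it is \<open>O(h\<^sup>2)\<close> on the edges, and then on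
  the chords that end on the boundary, which cover the polygon. A function which is \<open>O(h\<^sup>2)\<close> on
  a disc of radius comparable to the diameter and has bounded second derivatives has gradient
  \<open>O(h)\<close> there; so \<open>\<nu>\<close> and \<open>\<nu>\<^sub>h\<close> differ, up to sign, by \<open>O(h)\<close>. The Jacobian of the projection
  on the plane of the polygon is \<open>\<bar>\<nu> \<bullet> \<nu>\<^sub>h\<bar> + O(d) = 1 + O(h\<^sup>2)\<close>, and it equals \<open>\<delta>\<^sub>h\<close> almost
  everywhere by comparing integrals over the sets where they differ. Finally
  \<open>P P\<^sub>h P = P - (P \<nu>\<^sub>h) (P \<nu>\<^sub>h)\<^sup>T\<close> is \<open>P + O(h\<^sup>2)\<close>.
\<close>

subsection \<open>The closest-point projection\<close>

text \<open>Of the projection only existence and uniqueness of the decomposition are given, and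
  \<Gamma> need not be closed; even continuity has to be extracted from uniqueness.
  \<open>curvature\<close> yields a derivative \<open>S\<close> of the normal separately at each
  point. That suffices for differentiating and for mean value estimates, but comparing areas calls
  for patches with continuous partial derivatives, hence the separate continuity argument. The
  condition \<open>\<kappa> * \<bar>sd x\<bar> \<le> 1/2\<close> must hold before anything is
  differentiated: since the vertices lie on \<Gamma>, \<open>\<bar>sd\<bar>\<close> is at most the
  diameter of the element, and this first-order bound starts the bootstrap to second order. Elements
  need not be convex, so all estimates run along segments known to lie in the element: edges,
  chords, and segments from the centre of the disc, through whose radius \<gamma>1 enters the
  constant. The density is determined only almost everywhere, and the factor 1 / \<delta> in the
  operator R_h is the reason for a threshold on h.\<close>

locale fermi =
  fixes \<Gamma> :: "(real^3) set" and \<nu> :: "real^3 \<Rightarrow> real^3" and U :: "(real^3) set" and \<kappa> :: real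
  assumes surface: "oriented_C2_surface \<Gamma> \<nu>"
    and curvature: "p \<in> \<Gamma> \<Longrightarrow> \<exists>S. (\<nu> has_derivative S) (at p within \<Gamma>) \<and> onorm S \<le> \<kappa>"
    and stripe: "fermi_stripe \<Gamma> \<nu> U"
    and kappa_ge_1: "1 \<le> \<kappa>"
begin

abbreviation foot where "foot \<equiv> fermi_proj \<Gamma> \<nu>"
abbreviation sd where "sd \<equiv> oriented_dist \<Gamma> \<nu>"

lemma open_U: "open U"
  using stripe by (simp add: fermi_stripe_def)

lemma local_defining_function:
  assumes "p \<in> \<Gamma>"
  obtains W f g where "open W" "p \<in> W" "C2_on W f g" "\<Gamma> \<inter> W = {x\<in>W. f x = 0}"
    "\<And>x. x \<in> \<Gamma> \<Longrightarrow> x \<in> W \<Longrightarrow> g x \<noteq> 0" "\<And>x. x \<in> \<Gamma> \<Longrightarrow> x \<in> W \<Longrightarrow> \<nu> x = (1 / norm (g x)) *\<^sub>R g x"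
proof -
  obtain W f g where W: "open W" "p \<in> W" "C2_on W f g" "\<Gamma> \<inter> W = {x\<in>W. f x = 0}"
    and "\<forall>x\<in>\<Gamma> \<inter> W. g x \<noteq> 0 \<and> \<nu> x = (1 / norm (g x)) *\<^sub>R g x"
    using bspec[OF surface[unfolded oriented_C2_surface_def] assms] by (elim exE conjE) (rule that)
  then show ?thesis by (intro that[OF W]) auto
qed

lemma norm_normal: "p \<in> \<Gamma> \<Longrightarrow> norm (\<nu> p) = 1"
proof -
  assume p: "p \<in> \<Gamma>"
  then show ?thesis by (rule local_defining_function) (use p in auto)
qed

lemma decomposition:
  assumes "x \<in> U"
  shows "foot x \<in> \<Gamma>" "x = foot x + sd x *\<^sub>R \<nu> (foot x)" "\<bar>sd x\<bar> = infdist x \<Gamma>"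
proof -
  have "\<exists>!c. fermi_decomposition \<Gamma> \<nu> x c"
    using stripe assms by (simp add: fermi_stripe_def)
  then have "fermi_decomposition \<Gamma> \<nu> x (THE c. fermi_decomposition \<Gamma> \<nu> x c)"
    by (rule theI')
  moreover obtain z t where "(THE c. fermi_decomposition \<Gamma> \<nu> x c) = (z, t)"
    by (cases "THE c. fermi_decomposition \<Gamma> \<nu> x c")
  ultimately show "foot x \<in> \<Gamma>" "x = foot x + sd x *\<^sub>R \<nu> (foot x)" "\<bar>sd x\<bar> = infdist x \<Gamma>"
    by (simp_all add: fermi_proj_def oriented_dist_def fermi_decomposition_def)
qed

lemma foot_unique:
  assumes "x \<in> U" "z \<in> \<Gamma>" "x = z + t *\<^sub>R \<nu> z" "\<bar>t\<bar> = infdist x \<Gamma>"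
  shows "foot x = z"
proof -
  have ex1: "\<exists>!c. fermi_decomposition \<Gamma> \<nu> x c"
    using stripe assms by (simp add: fermi_stripe_def)
  have "fermi_decomposition \<Gamma> \<nu> x (z, t)"
    using assms by (simp add: fermi_decomposition_def)
  then have "(THE c. fermi_decomposition \<Gamma> \<nu> x c) = (z, t)"
    using ex1 by (rule the1_equality[rotated])
  then show ?thesis by (simp add: fermi_proj_def)
qed

lemma dist_foot: "x \<in> U \<Longrightarrow> dist x (foot x) = \<bar>sd x\<bar>"
  using decomposition[of x] norm_normal[of "foot x"]
  by (metis add_diff_cancel_left' dist_norm mult.right_neutral norm_scaleR)

lemma sd_on_surface: "x \<in> U \<Longrightarrow> x \<in> \<Gamma> \<Longrightarrow> sd x = 0"
  using decomposition(3)[of x] by simp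

text \<open>Moving \<open>x\<close> towards a nearest point \<open>z\<close> of the closure makes \<open>z\<close> the only
  candidate for the foot of the moved point, which puts \<open>x - z\<close> in the normal direction.\<close>

lemma nearest_point_unique:
  assumes x: "x \<in> U" and z: "z \<in> closure \<Gamma>" and xz: "dist x z = infdist x \<Gamma>"
  shows "foot x = z"
proof (cases "infdist x \<Gamma> = 0")
  case True
  then show ?thesis using dist_foot[OF x] decomposition(3)[OF x] xz by simp
next
  case False
  define r where "r = infdist x \<Gamma>"
  have r: "r > 0" using False infdist_nonneg[of x \<Gamma>] unfolding r_def by linarith
  obtain e where e: "e > 0" "ball x e \<subseteq> U" using open_U x open_contains_ball by blast
  \<comment> \<open>\<open>t * r < e\<close> keeps \<open>y\<close> in U, and \<open>t < 1\<close>
    allows division by 1 - t.\<close>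
  define t where "t = min (1/2) (e / (2 * r))"
  have t: "0 < t" "t < 1" using e r by (auto simp: t_def)
  have tr: "t * r < e"
  proof -
    have "t * r \<le> (e / (2 * r)) * r" using r by (intro mult_right_mono) (auto simp: t_def)
    also have "\<dots> < e" using r e by simp
    finally show ?thesis .
  qed
  define y where "y = x + t *\<^sub>R (z - x)"
  have xy: "dist x y = t * r"
    using t xz by (simp add: y_def dist_norm r_def norm_minus_commute)
  have yU: "y \<in> U" using e xy tr by auto
  define q where "q = foot y"
  have q: "q \<in> \<Gamma>" "y = q + sd y *\<^sub>R \<nu> q" "\<bar>sd y\<bar> = infdist y \<Gamma>"
    using decomposition[OF yU] by (auto simp: q_def)
  have yz: "y - z = (1 - t) *\<^sub>R (x - z)" by (simp add: y_def algebra_simps)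
  have "infdist z \<Gamma> = 0" using z q(1) by (subst in_closure_iff_infdist_zero[symmetric]) auto
  then have "infdist y \<Gamma> \<le> dist y z" using infdist_triangle[of y \<Gamma> z] by simp
  also have "\<dots> = (1 - t) * r" using t xz yz by (simp add: dist_norm r_def)
  finally have yq: "dist y q \<le> (1 - t) * r" using dist_foot[OF yU] q(3) by (simp add: q_def)
  have xq: "r \<le> dist x q" unfolding r_def by (rule infdist_le[OF q(1)])
  have "dist x q \<le> dist x y + dist y q" by (rule dist_triangle)
  then have eq: "dist x q = dist x y + dist y q" "dist y q = (1 - t) * r"
    using xq yq xy by (auto simp: algebra_simps)
  \<comment> \<open>Equality in the triangle inequality puts \<open>y\<close> on the segment from
    \<open>x\<close> to \<open>q\<close>; as the lengths are known, \<open>q\<close> can only be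
    \<open>z\<close>. In particular \<open>z\<close>, taken from the closure, belongs to
    \<Gamma>.\<close>
  then have "norm (x - y) *\<^sub>R (y - q) = norm (y - q) *\<^sub>R (x - y)"
    by (metis dist_triangle_eq norm_minus_commute dist_norm)
  then have "(t * r) *\<^sub>R (y - q) = ((1 - t) * r) *\<^sub>R (x - y)"
    using xy eq by (simp add: dist_norm)
  also have "x - y = t *\<^sub>R (x - z)" by (simp add: y_def algebra_simps)
  finally have "(t * r) *\<^sub>R (y - q) = (t * r) *\<^sub>R ((1 - t) *\<^sub>R (x - z))"
    by (simp add: algebra_simps)
  then have "y - q = (1 - t) *\<^sub>R (x - z)" using r t by (subst (asm) real_vector.scale_cancel_left) auto
  then have "y - q = y - z" using yz by simp
  then have qz: "q = z" by simp
  have "(1 - t) *\<^sub>R (x - z) = sd y *\<^sub>R \<nu> z"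
    using q(2) unfolding yz[symmetric] qz by (metis add_diff_cancel_left')
  then have "x - z = (1 / (1 - t)) *\<^sub>R (sd y *\<^sub>R \<nu> z)"
    using t by (metis diff_gt_0_iff_gt less_irrefl nonzero_divide_eq_eq scaleR_one scaleR_scaleR)
  then have dec: "x = z + (sd y / (1 - t)) *\<^sub>R \<nu> z" by (simp add: algebra_simps)
  have "dist x z = \<bar>sd y / (1 - t)\<bar>"
    using dec norm_normal q(1) qz by (metis add_diff_cancel_left' dist_norm mult.right_neutral norm_scaleR)
  then show ?thesis using foot_unique[OF x _ dec] q(1) qz xz by simp
qed

text \<open>Otherwise some sequence tending to \<open>x\<close> has feet at distance at least
  \<open>e\<close> from \<open>foot x\<close>. These are bounded, since \<open>infdist\<close>
  converges along the sequence, and a limit point of them realises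
  \<open>infdist x \<Gamma>\<close>. A priori it lies only in the closure of \<Gamma>, which is why
  \<open>nearest_point_unique\<close> is stated there.\<close>

lemma isCont_foot:
  assumes x: "x \<in> U" shows "isCont foot x"
proof -
  have "(\<lambda>n. foot (y n)) \<longlonglongrightarrow> foot x" if y: "y \<longlonglongrightarrow> x" for y :: "nat \<Rightarrow> real^3"
  proof (rule ccontr)
    assume "\<not> (\<lambda>n. foot (y n)) \<longlonglongrightarrow> foot x"
    then obtain e where e: "e > 0" "\<exists>\<^sub>F n in sequentially. \<not> dist (foot (y n)) (foot x) < e"
      by (auto simp: tendsto_iff not_eventually)
    have evU: "\<forall>\<^sub>F n in sequentially. y n \<in> U"
      using y open_U x by (rule topological_tendstoD)
    have "\<exists>\<^sub>F n in sequentially. \<not> dist (foot (y n)) (foot x) < e \<and> y n \<in> U"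
      using frequently_eventually_conj[OF e(2) evU] by (rule frequently_mono[rotated]) auto
    then have inf: "infinite {n. \<not> dist (foot (y n)) (foot x) < e \<and> y n \<in> U}"
      by (simp add: cofinite_eq_sequentially[symmetric] frequently_cofinite)
    define s where "s = enumerate {n. \<not> dist (foot (y n)) (foot x) < e \<and> y n \<in> U}"
    have s: "strict_mono s" "\<And>n. \<not> dist (foot (y (s n))) (foot x) < e" "\<And>n. y (s n) \<in> U"
      using strict_mono_enumerate[OF inf] enumerate_in_set[OF inf] by (auto simp: s_def)
    have ys: "(y \<circ> s) \<longlonglongrightarrow> x" using y s(1) by (rule LIMSEQ_subseq_LIMSEQ)
    have lim_inf: "(\<lambda>n. infdist (y (s n)) \<Gamma>) \<longlonglongrightarrow> infdist x \<Gamma>"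
      using tendsto_infdist[OF ys] by (simp add: o_def)
    have dst: "dist (y (s n)) (foot (y (s n))) = infdist (y (s n)) \<Gamma>" for n
      using dist_foot[OF s(3)] decomposition(3)[OF s(3)] by simp
    have "bounded (range (\<lambda>n. foot (y (s n))))"
    proof -
      obtain B1 where B1: "\<And>n. norm (y (s n)) \<le> B1"
        using convergent_imp_bounded[OF ys] by (auto simp: bounded_iff)
      obtain B2 where B2: "\<And>n. norm (infdist (y (s n)) \<Gamma>) \<le> B2"
        using convergent_imp_bounded[OF lim_inf] by (auto simp: bounded_iff)
      have "norm (foot (y (s n))) \<le> B1 + B2" for n
      proof -
        have "norm (foot (y (s n))) \<le> norm (y (s n)) + dist (y (s n)) (foot (y (s n)))"
          by (metis add.commute dist_commute dist_norm norm_triangle_sub)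
        then show ?thesis using B1[of n] B2[of n] dst[of n] by simp
      qed
      then show ?thesis by (auto simp: bounded_iff)
    qed
    then obtain z and k :: "nat \<Rightarrow> nat" where k: "strict_mono k" "((\<lambda>n. foot (y (s n))) \<circ> k) \<longlonglongrightarrow> z"
      using bounded_imp_convergent_subsequence by blast
    have zcl: "z \<in> closure \<Gamma>"
      unfolding closure_sequential using k(2) decomposition(1)[OF s(3)] by (intro exI[of _ "(\<lambda>n. foot (y (s n))) \<circ> k"]) auto
    have "(\<lambda>n. dist ((y \<circ> s \<circ> k) n) (((\<lambda>n. foot (y (s n))) \<circ> k) n)) \<longlonglongrightarrow> dist x z"
      using LIMSEQ_subseq_LIMSEQ[OF ys k(1)] k(2) by (rule tendsto_dist)
    moreover have "(\<lambda>n. infdist (y (s (k n))) \<Gamma>) \<longlonglongrightarrow> infdist x \<Gamma>"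
      using LIMSEQ_subseq_LIMSEQ[OF lim_inf k(1)] by (simp add: o_def)
    ultimately have "dist x z = infdist x \<Gamma>"
      using dst by (auto simp: o_def intro: LIMSEQ_unique)
    then have "foot x = z" using nearest_point_unique x zcl by blast
    moreover have "e \<le> dist z (foot x)"
    proof (rule tendsto_lowerbound)
      show "(\<lambda>n. dist (((\<lambda>n. foot (y (s n))) \<circ> k) n) (foot x)) \<longlonglongrightarrow> dist z (foot x)"
        using k(2) by (intro tendsto_intros)
      show "\<forall>\<^sub>F n in sequentially. e \<le> dist (((\<lambda>n. foot (y (s n))) \<circ> k) n) (foot x)"
        using s(2) by (simp add: not_less)
    qed simp
    ultimately show False using e by simp
  qed
  then show ?thesis by (simp add: continuous_at_sequentially o_def)
qed

lemma continuous_on_normal: "continuous_on \<Gamma> \<nu>"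
  using curvature by (meson continuous_on_eq_continuous_within has_derivative_continuous)

lemma isCont_normal_foot:
  assumes x: "x \<in> U" shows "isCont (\<lambda>y. \<nu> (foot y)) x"
proof -
  have "continuous_on U (\<lambda>y. \<nu> (foot y))"
    using continuous_on_normal isCont_foot decomposition(1)
    by (intro continuous_on_compose2[OF continuous_on_normal])
       (auto intro!: continuous_at_imp_continuous_on)
  then show ?thesis using open_U x by (simp add: continuous_on_eq_continuous_at)
qed

lemma isCont_sd:
  assumes x: "x \<in> U" shows "isCont sd x"
proof -
  have eq: "sd y = (y - foot y) \<bullet> \<nu> (foot y)" if "y \<in> U" for y
  proof -
    have "y - foot y = sd y *\<^sub>R \<nu> (foot y)" using decomposition(2)[OF that] by (metis add_diff_cancel_left')
    then show ?thesis using norm_normal[OF decomposition(1)[OF that]] by (simp add: norm_eq_1)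
  qed
  have "isCont (\<lambda>y. (y - foot y) \<bullet> \<nu> (foot y)) x"
    using isCont_foot[OF x] isCont_normal_foot[OF x] by (intro continuous_intros)
  moreover have "\<forall>\<^sub>F y in nhds x. sd y = (y - foot y) \<bullet> \<nu> (foot y)"
    using open_U x eq by (auto simp: eventually_nhds)
  ultimately show ?thesis by (simp add: isCont_cong)
qed

text \<open>\<open>f\<close> vanishes at \<open>p\<close> and at \<open>q\<close>, so its
  first-order expansion at \<open>p\<close> bounds \<open>g p \<bullet> (q - p)\<close>. In this
  form the smoothness of \<Gamma> enters the increments of the projection.\<close>

lemma tangency:
  assumes p: "p \<in> \<Gamma>" and e: "e > 0"
  shows "\<forall>\<^sub>F q in nhds p. q \<in> \<Gamma> \<longrightarrow> \<bar>\<nu> p \<bullet> (q - p)\<bar> \<le> e * norm (q - p)"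
proof -
  obtain W f g where W: "open W" "p \<in> W" "C2_on W f g" "\<Gamma> \<inter> W = {x\<in>W. f x = 0}"
      and g: "g p \<noteq> 0" "\<nu> p = (1 / norm (g p)) *\<^sub>R g p"
    by (rule local_defining_function[OF p]) (use p in blast)
  have "(f has_derivative (\<lambda>v. g p \<bullet> v)) (at p)" using W by (auto simp: C2_on_def)
  then have "\<exists>r>0. \<forall>q. norm (q - p) < r \<longrightarrow> norm (f q - f p - g p \<bullet> (q - p)) \<le> (e * norm (g p)) * norm (q - p)"
    using e g(1) unfolding has_derivative_at_alt by simp
  then obtain r where r: "r > 0" "\<And>q. norm (q - p) < r \<Longrightarrow> norm (f q - f p - g p \<bullet> (q - p)) \<le> (e * norm (g p)) * norm (q - p)"
    by blast
  have "\<forall>\<^sub>F q in nhds p. q \<in> W \<and> q \<in> ball p r"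
    using W r by (intro eventually_conj eventually_nhds_in_open) auto
  then show ?thesis
  proof (rule eventually_mono, safe)
    fix q assume q: "q \<in> W" "q \<in> ball p r" "q \<in> \<Gamma>"
    have "f q = 0" "f p = 0" using W p q by auto
    then have "\<bar>g p \<bullet> (q - p)\<bar> \<le> (e * norm (g p)) * norm (q - p)"
      using r(2)[of q] q by (simp add: dist_norm norm_minus_commute)
    then show "\<bar>\<nu> p \<bullet> (q - p)\<bar> \<le> e * norm (q - p)"
      using g by (simp add: abs_mult field_simps)
  qed
qed

end

subsection \<open>Derivatives of the projection and of the oriented distance\<close>

definition tproj :: "real^3 \<Rightarrow> real^3 \<Rightarrow> real^3" where
  "tproj n v = v - (n \<bullet> v) *\<^sub>R n"

lemma tangent_proj_vec: "tangent_proj n *v v = tproj n v"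
  by (simp add: vec_eq_iff tangent_proj_def tproj_def matrix_vector_mult_def inner_vec_def
      sum_3 forall_3 algebra_simps)

lemma linear_tproj: "linear (tproj n)"
  by (rule linearI) (simp_all add: tproj_def algebra_simps inner_add_right scaleR_add_left)

lemma tproj_orth: "norm n = 1 \<Longrightarrow> n \<bullet> tproj n v = 0"
  by (simp add: tproj_def inner_diff_right norm_eq_1)

lemma tproj_id: "n \<bullet> v = 0 \<Longrightarrow> tproj n v = v"
  by (simp add: tproj_def)

lemma norm_tproj_le:
  assumes "norm n = 1" shows "norm (tproj n v) \<le> norm v"
proof -
  have "(norm v)\<^sup>2 = (norm (tproj n v))\<^sup>2 + (n \<bullet> v)\<^sup>2"
    using assms unfolding power2_norm_eq_inner
    by (simp add: tproj_def norm_eq_1 inner_diff_left inner_diff_right inner_commute[of v n] power2_eq_square)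
  then have "(norm (tproj n v))\<^sup>2 \<le> (norm v)\<^sup>2" by simp
  then show ?thesis by (rule power2_le_imp_le) simp
qed

context fermi begin

text \<open>Let u, v, w be the increments of the projection, the point and the normal. Subtracting
  the two decompositions gives v = u + d(y) (n + w) - d(x) n, and projecting to the tangent plane
  removes the multiples of n. There u is tangential up to \<open>tangency\<close>, w is S u up to
  o(u), and d(y) is close to d(x). Errors are measured by norm u, which is bounded by norm v only
  afterwards.\<close>

lemma foot_increment:
  assumes x: "x \<in> U" and S: "(\<nu> has_derivative S) (at (foot x) within \<Gamma>)" "onorm S \<le> \<kappa>"
    and small: "\<kappa> * \<bar>sd x\<bar> \<le> 1/2" and e: "e > 0"
  shows "\<forall>\<^sub>F y in nhds x. y \<in> U \<and> norm (foot y - foot x) \<le> 4 * norm (y - x) \<and>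
    \<bar>\<nu> (foot x) \<bullet> (foot y - foot x)\<bar> \<le> e * norm (foot y - foot x) \<and>
    norm (\<nu> (foot y) - \<nu> (foot x) - S (foot y - foot x)) \<le> e * norm (foot y - foot x) \<and>
    \<bar>sd y - sd x\<bar> \<le> e \<and>
    norm ((foot y - foot x) + sd x *\<^sub>R tproj (\<nu> (foot x)) (S (foot y - foot x))
       - tproj (\<nu> (foot x)) (y - x)) \<le> e * norm (foot y - foot x)"
proof -
  define p where "p = foot x"
  define n where "n = \<nu> p"
  define D where "D = \<bar>sd x\<bar>"
  define c where "c = 2 + \<kappa> + D"
  have p: "p \<in> \<Gamma>" using decomposition(1)[OF x] by (simp add: p_def)
  have n: "norm n = 1" using norm_normal[OF p] by (simp add: n_def)
  have c: "c > 2" using kappa_ge_1 by (simp add: c_def D_def)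
  \<comment> \<open>\<open>c\<close> adds up three errors: 1 for the normal part of u, \<kappa> + 1
    for the change of d times w, and \<open>D\<close> for w - S u. The bound
    \<open>1 / (4 * c)\<close> serves the absorption of norm u below, \<open>e / c\<close> the final
    estimate.\<close>
  define \<epsilon> where "\<epsilon> = min 1 (min (1 / (4 * c)) (min e (e / c)))"
  have \<epsilon>: "\<epsilon> > 0" "\<epsilon> \<le> 1" "\<epsilon> \<le> 1 / (4 * c)" "\<epsilon> \<le> e" "\<epsilon> \<le> e / c"
    using c e by (auto simp: \<epsilon>_def)
  have \<epsilon>c: "\<epsilon> * c \<le> 1/4" "\<epsilon> * c \<le> e" using \<epsilon>(3,5) c by (auto simp: field_simps)
  have Sb: "bounded_linear S" using S(1) by (rule has_derivative_bounded_linear)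
  have Sn: "norm (S v) \<le> \<kappa> * norm v" for v
    using onorm[OF Sb, of v] S(2) by (meson dual_order.trans mult_right_mono norm_ge_zero)
  obtain r where r: "r > 0" "\<And>q. q \<in> \<Gamma> \<Longrightarrow> norm (q - p) < r \<Longrightarrow> norm (\<nu> q - \<nu> p - S (q - p)) \<le> \<epsilon> * norm (q - p)"
    using S(1)[folded p_def] \<epsilon>(1) unfolding has_derivative_within_alt by blast
  have filt: "filterlim foot (nhds p) (nhds x)"
    using isCont_foot[OF x] by (simp add: p_def isCont_def tendsto_at_iff_tendsto_nhds)
  have ev1: "\<forall>\<^sub>F y in nhds x. foot y \<in> \<Gamma> \<longrightarrow> \<bar>n \<bullet> (foot y - p)\<bar> \<le> \<epsilon> * norm (foot y - p)"
    using filt tangency[OF p \<epsilon>(1)] unfolding n_def by (rule filterlim_iff[THEN iffD1, rule_format])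
  have "\<forall>\<^sub>F q in nhds p. q \<in> ball p r" using r by (intro eventually_nhds_in_open) auto
  then have ev2: "\<forall>\<^sub>F y in nhds x. foot y \<in> ball p r"
    using filt filterlim_iff by blast
  have "filterlim sd (nhds (sd x)) (nhds x)"
    using isCont_sd[OF x] by (simp add: isCont_def tendsto_at_iff_tendsto_nhds)
  then have ev3: "\<forall>\<^sub>F y in nhds x. dist (sd y) (sd x) < \<epsilon>" using \<epsilon>(1) by (rule tendstoD)
  have ev4: "\<forall>\<^sub>F y in nhds x. y \<in> U" using open_U x by (rule eventually_nhds_in_open)
  from ev1 ev2 ev3 ev4 show ?thesis
    unfolding p_def[symmetric] n_def[symmetric]
  proof eventually_elim
    case (elim y)
    define u where "u = foot y - p"
    define v where "v = y - x"
    define w where "w = \<nu> (foot y) - n"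
    define \<Delta> where "\<Delta> = sd y - sd x"
    have q: "foot y \<in> \<Gamma>" using decomposition(1) elim by blast
    have E1: "\<bar>n \<bullet> u\<bar> \<le> \<epsilon> * norm u" using elim q by (simp add: u_def)
    have E2: "norm (w - S u) \<le> \<epsilon> * norm u"
      using r(2)[OF q] elim by (simp add: w_def u_def n_def dist_norm norm_minus_commute)
    have E3: "\<bar>\<Delta>\<bar> \<le> \<epsilon>" using elim by (simp add: \<Delta>_def dist_real_def)
    have w: "norm w \<le> (\<kappa> + 1) * norm u"
    proof -
      have "norm w \<le> norm (S u) + norm (w - S u)" by (metis add_diff_cancel_left' norm_triangle_sub add.commute)
      also have "\<dots> \<le> \<kappa> * norm u + 1 * norm u"
        using Sn[of u] E2 mult_right_mono[OF \<epsilon>(2) norm_ge_zero[of u]] by linarith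
      finally show ?thesis by (simp add: algebra_simps)
    qed
    have veq: "v = u + sd y *\<^sub>R (n + w) - sd x *\<^sub>R n"
      using decomposition(2)[OF x] decomposition(2)[of y] elim
      unfolding v_def u_def w_def p_def[symmetric] n_def[symmetric] by (smt (verit) add.commute add_diff_eq diff_add_cancel diff_diff_eq2)
    have Pn: "tproj n n = 0" using n by (simp add: tproj_def norm_eq_1)
    have Pv: "tproj n v = tproj n u + sd y *\<^sub>R tproj n w"
      unfolding veq using Pn
      by (simp add: linear_diff[OF linear_tproj] linear_add[OF linear_tproj] linear_cmul[OF linear_tproj])
    have Sdiff: "tproj n (w - S u) = tproj n w - tproj n (S u)" by (rule linear_diff[OF linear_tproj])
    have eq: "u + sd x *\<^sub>R tproj n (S u) - tproj n v =
        (n \<bullet> u) *\<^sub>R n - \<Delta> *\<^sub>R tproj n w - sd x *\<^sub>R tproj n (w - S u)"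
      unfolding Pv Sdiff by (simp add: tproj_def[of n u] \<Delta>_def algebra_simps)
    have "norm (u + sd x *\<^sub>R tproj n (S u) - tproj n v) \<le>
        norm ((n \<bullet> u) *\<^sub>R n) + norm (\<Delta> *\<^sub>R tproj n w) + norm (sd x *\<^sub>R tproj n (w - S u))"
      unfolding eq by (meson add_right_mono norm_triangle_ineq4 order_trans)
    also have "\<dots> = \<bar>n \<bullet> u\<bar> + \<bar>\<Delta>\<bar> * norm (tproj n w) + D * norm (tproj n (w - S u))"
      using n by (simp add: D_def)
    also have "\<dots> \<le> \<epsilon> * norm u + \<epsilon> * ((\<kappa> + 1) * norm u) + D * (\<epsilon> * norm u)"
      using E1 E2 E3 w norm_tproj_le[OF n, of w] norm_tproj_le[OF n, of "w - S u"] \<epsilon>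
      by (intro add_mono mult_mono) (auto simp: D_def)
    also have "\<dots> = (\<epsilon> * c) * norm u" by (simp add: c_def algebra_simps)
    finally have main: "norm (u + sd x *\<^sub>R tproj n (S u) - tproj n v) \<le> (\<epsilon> * c) * norm u" .
    have "norm (sd x *\<^sub>R tproj n (S u)) \<le> D * (\<kappa> * norm u)"
      using norm_tproj_le[OF n, of "S u"] Sn[of u] by (auto simp: D_def intro!: mult_left_mono)
    also have "\<dots> \<le> (1/2) * norm u"
      using small mult_right_mono[OF small norm_ge_zero[of u]] by (simp add: D_def algebra_simps)
    finally have half: "norm (sd x *\<^sub>R tproj n (S u)) \<le> (1/2) * norm u" .
    \<comment> \<open>Absorption: the right-hand side contains at most 1/4 + 1/2 of norm u itself,
      which leaves norm u \<le> 4 norm v.\<close>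
    have "norm u \<le> norm (u + sd x *\<^sub>R tproj n (S u) - tproj n v) + norm (sd x *\<^sub>R tproj n (S u)) + norm (tproj n v)"
      by (smt (verit) add_diff_cancel_right' norm_triangle_ineq4 norm_triangle_sub)
    then have "norm u \<le> (1/4) * norm u + (1/2) * norm u + norm v"
      using main half norm_tproj_le[OF n, of v] mult_right_mono[OF \<epsilon>c(1) norm_ge_zero[of u]] by linarith
    then have uv: "norm u \<le> 4 * norm v" by simp
    have mono: "\<epsilon> * norm u \<le> e * norm u" "(\<epsilon> * c) * norm u \<le> e * norm u"
      using \<epsilon> \<epsilon>c by (auto intro!: mult_right_mono)
    show ?case
      unfolding u_def[symmetric] v_def[symmetric] w_def[symmetric] \<Delta>_def[symmetric]
      using elim(4) uv E1 E2 E3 main mono \<epsilon>(4) by (auto intro: order_trans)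
  qed
qed

text \<open>The operator M u = u + d P S u satisfies norm u \<le> 2 norm (M u), because \<kappa>
  \<bar>d\<bar> \<le> 1/2; so it is invertible, and the derivative is its inverse composed with P. M
  does not change the normal component, which makes \<open>A\<close> tangential and onto the tangent
  plane.\<close>

lemma foot_has_derivative:
  assumes x: "x \<in> U" and S: "(\<nu> has_derivative S) (at (foot x) within \<Gamma>)" "onorm S \<le> \<kappa>"
    and small: "\<kappa> * \<bar>sd x\<bar> \<le> 1/2"
  obtains A where "(foot has_derivative A) (at x)"
    "\<And>v. A v + sd x *\<^sub>R tproj (\<nu> (foot x)) (S (A v)) = tproj (\<nu> (foot x)) v"
    "\<And>v. \<nu> (foot x) \<bullet> A v = 0" "\<And>v. norm (A v) \<le> 2 * norm v"
    "\<And>w. \<nu> (foot x) \<bullet> w = 0 \<Longrightarrow> \<exists>v. A v = w"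
proof -
  define n where "n = \<nu> (foot x)"
  have n: "norm n = 1" using norm_normal decomposition(1)[OF x] by (simp add: n_def)
  have Sb: "bounded_linear S" using S(1) by (rule has_derivative_bounded_linear)
  have Sn: "norm (S v) \<le> \<kappa> * norm v" for v
    using onorm[OF Sb, of v] S(2) by (meson dual_order.trans mult_right_mono norm_ge_zero)
  define M where "M = (\<lambda>u. u + sd x *\<^sub>R tproj n (S u))"
  have "linear (\<lambda>u. sd x *\<^sub>R tproj n (S u))"
    using linear_compose[OF bounded_linear.linear[OF Sb] linear_tproj[of n]]
    by (intro linear_compose_scale_right) (simp add: o_def)
  then have M: "linear M" unfolding M_def by (intro linear_compose_add linear_id[unfolded id_def])
  have low: "norm u \<le> 2 * norm (M u)" for u
  proof -
    have "norm (sd x *\<^sub>R tproj n (S u)) \<le> \<bar>sd x\<bar> * (\<kappa> * norm u)"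
      using norm_tproj_le[OF n, of "S u"] Sn[of u] by (auto intro!: mult_left_mono)
    also have "\<dots> \<le> (1/2) * norm u"
      using small mult_right_mono[OF small norm_ge_zero[of u]] by (simp add: algebra_simps)
    finally have half: "norm (sd x *\<^sub>R tproj n (S u)) \<le> (1/2) * norm u" .
    have "norm u \<le> norm (M u) + norm (sd x *\<^sub>R tproj n (S u))"
      unfolding M_def by (metis add_diff_cancel_right' norm_triangle_ineq4)
    then show ?thesis using half by simp
  qed
  have "inj M"
    unfolding linear_injective_0[OF M] using low by (metis mult_zero_right norm_le_zero_iff norm_zero)
  then obtain L where L: "linear L" "\<And>u. L (M u) = u" "\<And>u. M (L u) = u"
    using linear_injective_isomorphism[OF M] by blast
  define A where "A = (\<lambda>v. L (tproj n v))"
  have Ln: "norm (L v) \<le> 2 * norm v" for v using low[of "L v"] L(3) by simp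
  have A: "linear A" using linear_compose[OF linear_tproj[of n] L(1)] by (simp add: A_def o_def)
  have MA: "M (A v) = tproj n v" for v by (simp add: A_def L)
  have nM: "n \<bullet> M u = n \<bullet> u" for u by (simp add: M_def inner_add_right tproj_orth[OF n])
  have nA: "n \<bullet> A v = 0" for v using nM[of "A v"] MA[of v] tproj_orth[OF n] by simp
  have An: "norm (A v) \<le> 2 * norm v" for v
    using Ln[of "tproj n v"] norm_tproj_le[OF n, of v] by (simp add: A_def)
  have onto: "\<exists>v. A v = w" if "n \<bullet> w = 0" for w
  proof -
    have "tproj n (M w) = M w" using nM[of w] that by (simp add: tproj_id)
    then show ?thesis by (auto simp: A_def L intro: exI[of _ "M w"])
  qed
  have "(foot has_derivative A) (at x)"
    unfolding has_derivative_at_alt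
  proof (intro conjI allI impI)
    show "bounded_linear A" using A by (simp add: linear_conv_bounded_linear)
    fix e :: real assume e: "e > 0"
    \<comment> \<open>The 8 is 2 times 4: the bound for the inverse of \<open>M\<close> and the
      factor in norm u \<le> 4 norm (y - x).\<close>
    have "\<forall>\<^sub>F y in nhds x. norm (foot y - foot x - A (y - x)) \<le> e * norm (y - x)"
      using foot_increment[OF x S small, of "e / 8"] e unfolding n_def[symmetric]
    proof (simp, elim eventually_mono, goal_cases)
      case (1 y)
      define u where "u = foot y - foot x"
      have "u - A (y - x) = L (M u - tproj n (y - x))"
        by (simp add: A_def linear_diff[OF L(1)] L)
      then have "norm (u - A (y - x)) \<le> 2 * norm (M u - tproj n (y - x))" using Ln by simp
      also have "\<dots> \<le> 2 * (e / 8 * norm u)" using 1 by (simp add: M_def u_def)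
      also have "\<dots> \<le> 2 * (e / 8 * (4 * norm (y - x)))" using 1 e by (intro mult_left_mono) (auto simp: u_def)
      finally show ?case by (simp add: u_def)
    qed
    then obtain d where "d > 0" "\<And>y. dist y x < d \<Longrightarrow> norm (foot y - foot x - A (y - x)) \<le> e * norm (y - x)"
      unfolding eventually_nhds_metric by blast
    then show "\<exists>d>0. \<forall>y. norm (y - x) < d \<longrightarrow> norm (foot y - foot x - A (y - x)) \<le> e * norm (y - x)"
      by (auto simp: dist_norm)
  qed
  moreover have "A v + sd x *\<^sub>R tproj n (S (A v)) = tproj n v" for v
    using MA[of v] by (simp add: M_def)
  ultimately show ?thesis using that nA An onto unfolding n_def by blast
qed

text \<open>The inner product of v = u + d(y) (n + w) - d(x) n with n is d(y) - d(x) up to n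
  \<bullet> u and d(y) (w \<bullet> n). The first is o(norm u) by tangency. The second is quadratic:
  n and n + w are unit vectors, so w \<bullet> n is minus half the square of norm w.\<close>

lemma sd_has_derivative:
  assumes x: "x \<in> U" and small: "\<kappa> * \<bar>sd x\<bar> \<le> 1/2"
  shows "(sd has_derivative (\<lambda>v. \<nu> (foot x) \<bullet> v)) (at x)"
proof -
  define n where "n = \<nu> (foot x)"
  have n: "norm n = 1" using norm_normal decomposition(1)[OF x] by (simp add: n_def)
  obtain S where S: "(\<nu> has_derivative S) (at (foot x) within \<Gamma>)" "onorm S \<le> \<kappa>"
    using curvature decomposition(1)[OF x] by blast
  have Sb: "bounded_linear S" using S(1) by (rule has_derivative_bounded_linear)
  have Sn: "norm (S v) \<le> \<kappa> * norm v" for v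
    using onorm[OF Sb, of v] S(2) by (meson dual_order.trans mult_right_mono norm_ge_zero)
  show ?thesis unfolding has_derivative_at_alt n_def[symmetric]
  proof (intro conjI allI impI)
    show "bounded_linear ((\<bullet>) n)" by (rule bounded_linear_inner_right)
    fix e :: real assume e: "e > 0"
    \<comment> \<open>\<open>b\<close> is the coefficient of the quadratic term: \<bar>d(y)\<bar>
      \<le> \<bar>d(x)\<bar> + 1, and 8 is half of the square of 4 from norm u \<le> 4 norm v.
      Within the radius \<open>e / (2 * b)\<close> this term costs half of \<open>e\<close>;
      \<open>\<epsilon> \<le> e / 8\<close> leaves the other half to n \<bullet> u.\<close>
    define b where "b = (\<bar>sd x\<bar> + 1) * (8 * (\<kappa> + 1)\<^sup>2)"
    have b: "b > 0" using kappa_ge_1 by (simp add: b_def add_nonneg_pos)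
    define \<epsilon> where "\<epsilon> = min 1 (e / 8)"
    have \<epsilon>: "\<epsilon> > 0" "\<epsilon> \<le> 1" "\<epsilon> \<le> e / 8" using e by (auto simp: \<epsilon>_def)
    have "\<forall>\<^sub>F y in nhds x. y \<in> ball x (e / (2 * b))"
      using e b by (intro eventually_nhds_in_open) auto
    then have "\<forall>\<^sub>F y in nhds x. norm (sd y - sd x - n \<bullet> (y - x)) \<le> e * norm (y - x)"
      using foot_increment[OF x S small \<epsilon>(1)] unfolding n_def[symmetric]
    proof eventually_elim
      case (elim y)
      define u where "u = foot y - foot x"
      define v where "v = y - x"
      define w where "w = \<nu> (foot y) - n"
      have q: "norm (n + w) = 1" using norm_normal decomposition(1) elim by (simp add: w_def)
      have uv: "norm u \<le> 4 * norm v" using elim by (simp add: u_def v_def)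
      have wn: "\<bar>w \<bullet> n\<bar> = (norm w)\<^sup>2 / 2"
      proof -
        have "(n + w) \<bullet> (n + w) = 1" "n \<bullet> n = 1" using q n by (simp_all only: norm_eq_1)
        then have "w \<bullet> n = - (norm w)\<^sup>2 / 2"
          by (simp add: power2_norm_eq_inner inner_add_left inner_add_right inner_commute)
        then show ?thesis by simp
      qed
      have "norm w \<le> norm (S u) + norm (w - S u)" by (metis add_diff_cancel_left' norm_triangle_sub add.commute)
      also have "\<dots> \<le> \<kappa> * norm u + 1 * norm u"
      proof -
        have "norm (w - S u) \<le> \<epsilon> * norm u" using elim by (simp add: w_def u_def)
        then show ?thesis using Sn[of u] mult_right_mono[OF \<epsilon>(2) norm_ge_zero[of u]] by linarith
      qed
      finally have "norm w \<le> (\<kappa> + 1) * norm u" by (simp add: algebra_simps)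
      also have "\<dots> \<le> (\<kappa> + 1) * (4 * norm v)" using uv kappa_ge_1 by (intro mult_left_mono) auto
      finally have "(norm w)\<^sup>2 \<le> ((\<kappa> + 1) * (4 * norm v))\<^sup>2" by (intro power_mono) auto
      also have "\<dots> = 16 * (\<kappa> + 1)\<^sup>2 * (norm v * norm v)"
        by (simp add: power_mult_distrib power2_eq_square)
      finally have wn2: "\<bar>w \<bullet> n\<bar> \<le> 8 * (\<kappa> + 1)\<^sup>2 * (norm v * norm v)"
        unfolding wn by simp
      have veq: "v = u + sd y *\<^sub>R (n + w) - sd x *\<^sub>R n"
        using decomposition(2)[OF x] decomposition(2)[of y] elim
        unfolding v_def u_def w_def n_def[symmetric] by (smt (verit) add.commute add_diff_eq diff_add_cancel diff_diff_eq2)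
      have "sd y - sd x - n \<bullet> v = - (n \<bullet> u) - sd y * (w \<bullet> n)"
        unfolding veq using n by (simp add: norm_eq_1 inner_add_right inner_diff_right inner_commute algebra_simps)
      then have "\<bar>sd y - sd x - n \<bullet> v\<bar> \<le> \<bar>n \<bullet> u\<bar> + \<bar>sd y\<bar> * \<bar>w \<bullet> n\<bar>"
        by (metis abs_minus_cancel abs_mult abs_triangle_ineq4)
      also have "\<dots> \<le> e / 8 * (4 * norm v) + (\<bar>sd x\<bar> + 1) * (8 * (\<kappa> + 1)\<^sup>2 * (norm v * norm v))"
      proof (intro add_mono mult_mono wn2)
        have "\<bar>n \<bullet> u\<bar> \<le> \<epsilon> * norm u" using elim by (simp add: u_def)
        also have "\<dots> \<le> e / 8 * (4 * norm v)" using uv \<epsilon> by (intro mult_mono) auto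
        finally show "\<bar>n \<bullet> u\<bar> \<le> e / 8 * (4 * norm v)" .
        have "\<bar>sd y - sd x\<bar> \<le> 1" using elim \<epsilon>(2) by simp
        then show "\<bar>sd y\<bar> \<le> \<bar>sd x\<bar> + 1" by linarith
      qed auto
      also have "\<dots> = e / 2 * norm v + (b * norm v) * norm v" by (simp add: b_def algebra_simps)
      also have "\<dots> \<le> e / 2 * norm v + e / 2 * norm v"
      proof -
        have "norm v < e / (2 * b)" using elim by (simp add: v_def dist_norm norm_minus_commute)
        then have "b * norm v \<le> e / 2" using b by (simp add: field_simps)
        then show ?thesis by (intro add_left_mono mult_right_mono) auto
      qed
      finally show ?case by (simp add: v_def)
    qed
    then obtain d where "d > 0" "\<And>y. dist y x < d \<Longrightarrow> norm (sd y - sd x - n \<bullet> (y - x)) \<le> e * norm (y - x)"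
      unfolding eventually_nhds_metric by blast
    then show "\<exists>d>0. \<forall>y. norm (y - x) < d \<longrightarrow> norm (sd y - sd x - n \<bullet> (y - x)) \<le> e * norm (y - x)"
      by (auto simp: dist_norm)
  qed
qed

end

section \<open>Derivatives as functions of the point, and mean value estimates along
  segments\<close>

context fermi begin

abbreviation Dfoot where "Dfoot x \<equiv> frechet_derivative foot (at x)"
abbreviation Dnormal where "Dnormal x \<equiv> frechet_derivative (ext_normal \<Gamma> \<nu>) (at x)"

text \<open>The normal is differentiable within \<Gamma> only, so the chain rule is applied within
  U, which the projection maps into \<Gamma>; openness of U then gives a full derivative. It is S
  composed with A, and stating everything through \<open>Dfoot\<close> and \<open>Dnormal\<close>
  eliminates the unspecified \<open>S\<close>.\<close>

lemma derivatives_at: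
  assumes x: "x \<in> U" and small: "\<kappa> * \<bar>sd x\<bar> \<le> 1/2"
  shows foot_has_Dfoot: "(foot has_derivative Dfoot x) (at x)"
    and normal_has_Dnormal: "(ext_normal \<Gamma> \<nu> has_derivative Dnormal x) (at x)"
    and Dfoot_equation: "Dfoot x v + sd x *\<^sub>R tproj (\<nu> (foot x)) (Dnormal x v) = tproj (\<nu> (foot x)) v"
    and Dfoot_tangent: "\<nu> (foot x) \<bullet> Dfoot x v = 0"
    and norm_Dfoot_le: "norm (Dfoot x v) \<le> 2 * norm v"
    and norm_Dnormal_le: "norm (Dnormal x v) \<le> \<kappa> * norm (Dfoot x v)"
    and Dfoot_onto: "\<nu> (foot x) \<bullet> w = 0 \<Longrightarrow> \<exists>v. Dfoot x v = w"
proof -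
  obtain S where S: "(\<nu> has_derivative S) (at (foot x) within \<Gamma>)" "onorm S \<le> \<kappa>"
    using curvature decomposition(1)[OF x] by blast
  obtain A where A: "(foot has_derivative A) (at x)"
    "\<And>v. A v + sd x *\<^sub>R tproj (\<nu> (foot x)) (S (A v)) = tproj (\<nu> (foot x)) v"
    "\<And>v. \<nu> (foot x) \<bullet> A v = 0" "\<And>v. norm (A v) \<le> 2 * norm v"
    "\<And>w. \<nu> (foot x) \<bullet> w = 0 \<Longrightarrow> \<exists>v. A v = w"
    using foot_has_derivative[OF x S small] by blast
  have "(foot has_derivative A) (at x within U)" using A(1) by (rule has_derivative_at_withinI)
  moreover have "(\<nu> has_derivative S) (at (foot x) within foot ` U)"
    using S(1) decomposition(1) by (intro has_derivative_subset[OF S(1)]) auto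
  ultimately have "((\<lambda>y. \<nu> (foot y)) has_derivative (\<lambda>v. S (A v))) (at x within U)"
    by (rule has_derivative_in_compose)
  then have "((\<lambda>y. \<nu> (foot y)) has_derivative (\<lambda>v. S (A v))) (at x)"
    unfolding at_within_open[OF x open_U] .
  then have N: "(ext_normal \<Gamma> \<nu> has_derivative (\<lambda>v. S (A v))) (at x)"
    unfolding ext_normal_def[abs_def] .
  have eqA: "Dfoot x = A" using A(1) by (rule frechet_derivative_at[symmetric])
  have eqN: "Dnormal x = (\<lambda>v. S (A v))" using N by (rule frechet_derivative_at[symmetric])
  show "(foot has_derivative Dfoot x) (at x)" "(ext_normal \<Gamma> \<nu> has_derivative Dnormal x) (at x)"
    "Dfoot x v + sd x *\<^sub>R tproj (\<nu> (foot x)) (Dnormal x v) = tproj (\<nu> (foot x)) v"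
    "\<nu> (foot x) \<bullet> Dfoot x v = 0" "norm (Dfoot x v) \<le> 2 * norm v"
    "\<nu> (foot x) \<bullet> w = 0 \<Longrightarrow> \<exists>v. Dfoot x v = w"
    unfolding eqA eqN by (fact A N)+
  show "norm (Dnormal x v) \<le> \<kappa> * norm (Dfoot x v)"
    unfolding eqA eqN using onorm[OF has_derivative_bounded_linear[OF S(1)], of "A v"] S(2)
    by (meson dual_order.trans mult_right_mono norm_ge_zero)
qed

lemma norm_Dnormal_le': "x \<in> U \<Longrightarrow> \<kappa> * \<bar>sd x\<bar> \<le> 1/2 \<Longrightarrow> norm (Dnormal x v) \<le> 2 * \<kappa> * norm v"
  by (rule order_trans[OF norm_Dnormal_le]) (use norm_Dfoot_le[of x v] kappa_ge_1 in auto)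

lemma norm_Dfoot_minus_tproj_le:
  assumes x: "x \<in> U" and small: "\<kappa> * \<bar>sd x\<bar> \<le> 1/2"
  shows "norm (Dfoot x v - tproj (\<nu> (foot x)) v) \<le> 2 * \<kappa> * \<bar>sd x\<bar> * norm v"
proof -
  have "Dfoot x v - tproj (\<nu> (foot x)) v = - (sd x *\<^sub>R tproj (\<nu> (foot x)) (Dnormal x v))"
    by (simp add: Dfoot_equation[OF x small, of v, symmetric])
  then have "norm (Dfoot x v - tproj (\<nu> (foot x)) v) = \<bar>sd x\<bar> * norm (tproj (\<nu> (foot x)) (Dnormal x v))"
    by simp
  also have "\<dots> \<le> \<bar>sd x\<bar> * (2 * \<kappa> * norm v)"
    using norm_tproj_le[OF norm_normal[OF decomposition(1)[OF x]]] norm_Dnormal_le'[OF x small]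
    by (intro mult_left_mono) (auto intro: order_trans)
  finally show ?thesis by (simp add: algebra_simps)
qed

text \<open>The mean value inequality asks for a convex set; as neither U nor an element has to be
  convex, it is applied on a single segment.\<close>

lemma normal_segment_bound:
  assumes U: "closed_segment x y \<subseteq> U" and small: "\<And>z. z \<in> closed_segment x y \<Longrightarrow> \<kappa> * \<bar>sd z\<bar> \<le> 1/2"
  shows "norm (\<nu> (foot y) - \<nu> (foot x)) \<le> 2 * \<kappa> * dist x y"
proof -
  have "norm (ext_normal \<Gamma> \<nu> y - ext_normal \<Gamma> \<nu> x) \<le> (2 * \<kappa>) * norm (y - x)"
  proof (rule differentiable_bound[of "closed_segment x y" _ Dnormal])
    fix z assume z: "z \<in> closed_segment x y"
    then have "z \<in> U" using U by blast
    then show "(ext_normal \<Gamma> \<nu> has_derivative Dnormal z) (at z within closed_segment x y)"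
      using normal_has_Dnormal small[OF z] by (blast intro: has_derivative_at_withinI)
    show "onorm (Dnormal z) \<le> 2 * \<kappa>"
      using norm_Dnormal_le'[OF \<open>z \<in> U\<close> small[OF z]] kappa_ge_1 by (intro onorm_bound) auto
  qed auto
  then show ?thesis by (simp add: ext_normal_def dist_norm norm_minus_commute)
qed

text \<open>A second-order Taylor estimate from first derivatives: subtracting the linear function
  with gradient \<open>\<nu> (foot x)\<close> leaves a gradient bounded by 2 \<kappa> dist x y on
  the segment.\<close>

lemma sd_segment_expansion:
  assumes U: "closed_segment x y \<subseteq> U" and small: "\<And>z. z \<in> closed_segment x y \<Longrightarrow> \<kappa> * \<bar>sd z\<bar> \<le> 1/2"
  shows "\<bar>sd y - sd x - \<nu> (foot x) \<bullet> (y - x)\<bar> \<le> 2 * \<kappa> * (dist x y)\<^sup>2"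
proof -
  have "norm ((sd y - \<nu> (foot x) \<bullet> y) - (sd x - \<nu> (foot x) \<bullet> x)) \<le> (2 * \<kappa> * dist x y) * norm (y - x)"
  proof (rule differentiable_bound[of "closed_segment x y" "\<lambda>z. sd z - \<nu> (foot x) \<bullet> z"
        "\<lambda>z v. \<nu> (foot z) \<bullet> v - \<nu> (foot x) \<bullet> v"])
    fix z assume z: "z \<in> closed_segment x y"
    then have zU: "z \<in> U" using U by blast
    have sub: "closed_segment x z \<subseteq> closed_segment x y" using z by (simp add: subset_closed_segment)
    have "norm (\<nu> (foot z) - \<nu> (foot x)) \<le> 2 * \<kappa> * dist x z"
      using sub U small by (intro normal_segment_bound) auto
    also have "\<dots> \<le> 2 * \<kappa> * dist x y"
      using dist_in_closed_segment[OF z] kappa_ge_1 by (intro mult_left_mono) (auto simp: dist_commute)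
    finally have le: "norm (\<nu> (foot z) - \<nu> (foot x)) \<le> 2 * \<kappa> * dist x y" .
    show "((\<lambda>z. sd z - \<nu> (foot x) \<bullet> z) has_derivative (\<lambda>v. \<nu> (foot z) \<bullet> v - \<nu> (foot x) \<bullet> v))
        (at z within closed_segment x y)"
      using has_derivative_at_withinI[OF sd_has_derivative[OF zU small[OF z]]]
      by (intro derivative_intros) auto
    show "onorm (\<lambda>v. \<nu> (foot z) \<bullet> v - \<nu> (foot x) \<bullet> v) \<le> 2 * \<kappa> * dist x y"
    proof (rule onorm_bound)
      fix v
      have "norm (\<nu> (foot z) \<bullet> v - \<nu> (foot x) \<bullet> v) \<le> norm (\<nu> (foot z) - \<nu> (foot x)) * norm v"
        by (metis Cauchy_Schwarz_ineq2 inner_diff_left real_norm_def)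
      also have "\<dots> \<le> (2 * \<kappa> * dist x y) * norm v" using le by (rule mult_right_mono) simp
      finally show "norm (\<nu> (foot z) \<bullet> v - \<nu> (foot x) \<bullet> v) \<le> (2 * \<kappa> * dist x y) * norm v" .
    qed (use kappa_ge_1 in simp)
  qed auto
  moreover have "sd y - sd x - \<nu> (foot x) \<bullet> (y - x) = (sd y - \<nu> (foot x) \<bullet> y) - (sd x - \<nu> (foot x) \<bullet> x)"
    by (simp add: inner_diff_right)
  ultimately show ?thesis by (simp add: dist_norm norm_minus_commute power2_eq_square mult.assoc)
qed

text \<open>Both endpoints are expanded at \<open>x\<close>. In the convex combination that
  represents \<open>x\<close> the gradient terms cancel, and only the two remainders
  survive.\<close>

lemma sd_segment_interpolation:
  assumes U: "closed_segment y z \<subseteq> U" and small: "\<And>z'. z' \<in> closed_segment y z \<Longrightarrow> \<kappa> * \<bar>sd z'\<bar> \<le> 1/2"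
    and x: "x \<in> closed_segment y z" and m: "\<bar>sd y\<bar> \<le> m" "\<bar>sd z\<bar> \<le> m"
  shows "\<bar>sd x\<bar> \<le> m + 2 * \<kappa> * (dist y z)\<^sup>2"
proof -
  define l where "l = 2 * \<kappa> * (dist y z)\<^sup>2"
  have bnd: "\<bar>sd w - sd x - \<nu> (foot x) \<bullet> (w - x)\<bar> \<le> l" if w: "w \<in> {y, z}" for w
  proof -
    have sub: "closed_segment x w \<subseteq> closed_segment y z" using x w by (subst subset_closed_segment) auto
    have "\<bar>sd w - sd x - \<nu> (foot x) \<bullet> (w - x)\<bar> \<le> 2 * \<kappa> * (dist x w)\<^sup>2"
      using sub U small by (intro sd_segment_expansion) auto
    also have "\<dots> \<le> l"
      unfolding l_def using kappa_ge_1 w dist_in_closed_segment[OF x]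
      by (intro mult_left_mono power_mono) auto
    finally show ?thesis .
  qed
  obtain t where t: "0 \<le> t" "t \<le> 1" "x = (1 - t) *\<^sub>R y + t *\<^sub>R z" using x by (auto simp: in_segment)
  define \<alpha> where "\<alpha> = sd y - sd x - \<nu> (foot x) \<bullet> (y - x)"
  define \<beta> where "\<beta> = sd z - sd x - \<nu> (foot x) \<bullet> (z - x)"
  have zero: "(1 - t) * (\<nu> (foot x) \<bullet> (y - x)) + t * (\<nu> (foot x) \<bullet> (z - x)) = 0"
  proof -
    have "(1 - t) * (\<nu> (foot x) \<bullet> (y - x)) + t * (\<nu> (foot x) \<bullet> (z - x))
      = \<nu> (foot x) \<bullet> ((1 - t) *\<^sub>R (y - x) + t *\<^sub>R (z - x))"
      by (simp add: inner_add_right)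
    also have "(1 - t) *\<^sub>R (y - x) + t *\<^sub>R (z - x) = 0" unfolding t(3) by (simp add: algebra_simps)
    finally show ?thesis by simp
  qed
  have "sd x = (1 - t) * (sd y - \<alpha>) + t * (sd z - \<beta>)"
    using zero unfolding \<alpha>_def \<beta>_def by (simp add: algebra_simps)
  also have "\<bar>\<dots>\<bar> \<le> (1 - t) * (m + l) + t * (m + l)"
  proof -
    have "\<bar>sd y - \<alpha>\<bar> \<le> m + l" "\<bar>sd z - \<beta>\<bar> \<le> m + l"
      using bnd[of y] bnd[of z] m unfolding \<alpha>_def \<beta>_def by auto
    then have "\<bar>(1 - t) * (sd y - \<alpha>)\<bar> \<le> (1 - t) * (m + l)" "\<bar>t * (sd z - \<beta>)\<bar> \<le> t * (m + l)"
      using t by (simp_all add: abs_mult mult_left_mono)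
    then show ?thesis by linarith
  qed
  also have "\<dots> = m + l" by (simp add: algebra_simps)
  finally show ?thesis by (simp add: l_def)
qed

end

subsection \<open>Polygons\<close>

definition poly_inside :: "(real^3) list \<Rightarrow> (real^3) set" where
  "poly_inside vs = poly_region vs - poly_boundary vs"

lemma poly_inside_iff:
  "x \<in> poly_inside vs \<longleftrightarrow> x \<in> affine hull set vs - poly_boundary vs \<and>
     bounded (connected_component_set (affine hull set vs - poly_boundary vs) x)"
  by (auto simp: poly_inside_def poly_region_def)

lemma poly_region_eq: "poly_region vs = poly_boundary vs \<union> poly_inside vs"
  by (auto simp: poly_inside_def poly_region_def)

lemma compact_poly_boundary: "compact (poly_boundary vs)"
  by (auto simp: poly_boundary_def poly_edge_def)

lemma vertex_in_boundary: "v \<in> set vs \<Longrightarrow> v \<in> poly_boundary vs"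
  by (auto simp: poly_boundary_def poly_edge_def in_set_conv_nth)

lemma connected_subset_inside:
  assumes x: "x \<in> poly_inside vs" and C: "connected C" "x \<in> C" "C \<subseteq> affine hull set vs - poly_boundary vs"
  shows "C \<subseteq> poly_inside vs"
proof
  fix y assume y: "y \<in> C"
  let ?X = "affine hull set vs - poly_boundary vs"
  have "C \<subseteq> connected_component_set ?X x" using C by (intro connected_component_maximal)
  then have "connected_component_set ?X y = connected_component_set ?X x"
    using y by (intro connected_component_eq) auto
  then show "y \<in> poly_inside vs" using x y C by (auto simp: poly_inside_iff)
qed

text \<open>A ray missing the boundary would be an unbounded connected subset of the component of
  \<open>x\<close>, which is bounded. The hitting times form a closed set, so there is a first one,
  and before it the ray stays in that component.\<close>

lemma ray_hits_boundary:
  assumes x: "x \<in> poly_inside vs" and w: "w \<noteq> 0" "\<And>t. x + t *\<^sub>R w \<in> affine hull set vs"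
  obtains t where "t > 0" "x + t *\<^sub>R w \<in> poly_boundary vs"
    "\<And>s. 0 \<le> s \<Longrightarrow> s < t \<Longrightarrow> x + s *\<^sub>R w \<in> poly_inside vs"
proof -
  define T where "T = {t. 0 \<le> t \<and> x + t *\<^sub>R w \<in> poly_boundary vs}"
  have xb: "x \<notin> poly_boundary vs" using x by (simp add: poly_inside_def)
  have conn: "connected ((\<lambda>t. x + t *\<^sub>R w) ` I)" if "connected I" for I
    using that by (intro connected_continuous_image continuous_intros)
  have "closed T"
  proof -
    have "T = {0..} \<inter> (\<lambda>t. x + t *\<^sub>R w) -` poly_boundary vs" by (auto simp: T_def)
    moreover have "closed ((\<lambda>t. x + t *\<^sub>R w) -` poly_boundary vs)"
      using compact_imp_closed[OF compact_poly_boundary]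
      by (intro continuous_closed_vimage continuous_intros)
    ultimately show ?thesis by auto
  qed
  have "T \<noteq> {}"
  proof
    assume "T = {}"
    let ?R = "(\<lambda>t. x + t *\<^sub>R w) ` {0..}"
    have "?R \<subseteq> affine hull set vs - poly_boundary vs" using \<open>T = {}\<close> w by (auto simp: T_def)
    moreover have "x \<in> ?R" by (intro image_eqI[of _ _ 0]) auto
    ultimately have "?R \<subseteq> connected_component_set (affine hull set vs - poly_boundary vs) x"
      using conn[of "{0..}"] by (intro connected_component_maximal) (auto simp: is_interval_connected_1[symmetric] is_interval_ci)
    then have "bounded ?R" using x bounded_subset by (auto simp: poly_inside_iff)
    then obtain B where B: "\<And>t. t \<ge> 0 \<Longrightarrow> norm (x + t *\<^sub>R w) \<le> B" by (auto simp: bounded_iff)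
    \<comment> \<open>So large that norm (x + t w) is at least t norm w - norm x = B + 1.\<close>
    define t where "t = (B + norm x + 1) / norm w"
    have "B \<ge> 0" using B[of 0] by (auto intro: order_trans[OF norm_ge_zero])
    then have t: "t \<ge> 0" "t * norm w = B + norm x + 1" using w by (auto simp: t_def)
    have "norm (t *\<^sub>R w) \<le> norm (x + t *\<^sub>R w) + norm x"
      by (metis add_diff_cancel_left' norm_triangle_ineq4)
    then show False using B[OF t(1)] t by simp
  qed
  define t where "t = Inf T"
  have "bdd_below T" by (auto simp: T_def intro: bdd_belowI[of _ 0])
  then have tT: "t \<in> T" unfolding t_def using \<open>closed T\<close> \<open>T \<noteq> {}\<close> by (intro closed_contains_Inf)
  have least: "t \<le> s" if "s \<in> T" for s unfolding t_def using that \<open>bdd_below T\<close> by (rule cInf_lower)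
  have "t \<noteq> 0" using tT xb by (auto simp: T_def)
  then have "t > 0" using tT by (auto simp: T_def)
  moreover have "x + s *\<^sub>R w \<in> poly_inside vs" if s: "0 \<le> s" "s < t" for s
  proof -
    have "(\<lambda>t. x + t *\<^sub>R w) ` {0..s} \<subseteq> poly_inside vs"
    proof (rule connected_subset_inside[OF x conn])
      show "x \<in> (\<lambda>t. x + t *\<^sub>R w) ` {0..s}" using s by (intro image_eqI[of _ _ 0]) auto
      show "(\<lambda>t. x + t *\<^sub>R w) ` {0..s} \<subseteq> affine hull set vs - poly_boundary vs"
        using w least s by (force simp: T_def)
    qed auto
    then show ?thesis using s by (auto simp: image_subset_iff)
  qed
  ultimately show ?thesis using that tT by (auto simp: T_def)
qed

lemma affine_ray:
  assumes "affine S" "x \<in> S" "y \<in> S" "z \<in> S"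
  shows "x + t *\<^sub>R (y - z) \<in> S"
  using assms mem_affine_3_minus by blast

text \<open>The ray from a vertex \<open>b\<close> through an inside point, continued beyond that
  point, meets the boundary farther from \<open>b\<close>; so a ball around \<open>b\<close> that
  contains the boundary contains the inside too. Boundedness is what makes \<open>diameter\<close>
  an upper bound for distances.\<close>

lemma bounded_poly_region: "bounded (poly_region vs)"
proof (cases "vs = []")
  case True
  then show ?thesis by (simp add: poly_region_def poly_boundary_def)
next
  case False
  define b where "b = hd vs"
  have b: "b \<in> affine hull set vs" using False by (auto simp: b_def intro: hull_inc)
  obtain R where R: "poly_boundary vs \<subseteq> cball b R"
    using compact_imp_bounded[OF compact_poly_boundary, of vs, unfolded bounded_any_center[of _ b]]
    by (auto simp: subset_iff)
  have "poly_inside vs \<subseteq> cball b R"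
  proof (rule ccontr)
    assume "\<not> poly_inside vs \<subseteq> cball b R"
    then obtain x where x: "x \<in> poly_inside vs" "R < dist b x" by (meson mem_cball not_le subsetI)
    have xh: "x \<in> affine hull set vs" using x by (simp add: poly_inside_iff)
    have ne: "x - b \<noteq> 0"
    proof
      assume "x - b = 0"
      then have "b \<notin> poly_boundary vs" using x by (simp add: poly_inside_iff)
      then show False using False vertex_in_boundary[of b vs] by (simp add: b_def)
    qed
    obtain t where t: "t > 0" "x + t *\<^sub>R (x - b) \<in> poly_boundary vs"
      using ray_hits_boundary[OF x(1) ne] affine_ray[OF affine_affine_hull xh xh b] by metis
    then have "dist b (x + t *\<^sub>R (x - b)) \<le> R" using R by auto
    moreover have "dist b (x + t *\<^sub>R (x - b)) = (1 + t) * dist b x"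
    proof -
      have "x + t *\<^sub>R (x - b) - b = (1 + t) *\<^sub>R (x - b)" by (simp add: algebra_simps)
      then show ?thesis using t by (metis abs_of_pos add_pos_pos dist_commute dist_norm norm_scaleR zero_less_one)
    qed
    moreover have "dist b x \<le> (1 + t) * dist b x" using t by (simp add: algebra_simps)
    ultimately show False using x by simp
  qed
  then show ?thesis
    using R by (auto simp: poly_region_eq intro: bounded_subset[OF bounded_cball])
qed

text \<open>A ball that avoids the boundary meets the plane in a convex, hence connected, set. This
  relative openness provides the open parameter domain in
  \<open>element_area_density\<close>.\<close>

lemma poly_inside_open:
  assumes x: "x \<in> poly_inside vs"
  obtains r where "r > 0" "ball x r \<inter> affine hull set vs \<subseteq> poly_inside vs"
proof -
  have "x \<in> - poly_boundary vs" "open (- poly_boundary vs)"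
    using x compact_imp_closed[OF compact_poly_boundary] by (auto simp: poly_inside_def)
  then obtain r where r: "r > 0" "ball x r \<subseteq> - poly_boundary vs" by (meson open_contains_ball)
  have "ball x r \<inter> affine hull set vs \<subseteq> poly_inside vs"
    using r x by (intro connected_subset_inside[OF x])
      (auto simp: poly_inside_iff intro!: convex_connected convex_Int intro: affine_imp_convex)
  then show ?thesis using that r by blast
qed

text \<open>Two opposite rays from \<open>x\<close> are followed to their first boundary points; the
  edge direction merely supplies a nonzero vector of the plane. Chords carry estimates from the
  boundary to the inside of a polygon that need not be convex.\<close>

lemma chord_through_inside:
  assumes x: "x \<in> poly_inside vs" and vs: "distinct vs" "3 \<le> length vs"
  obtains y z where "y \<in> poly_boundary vs" "z \<in> poly_boundary vs" "x \<in> closed_segment y z"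
    "closed_segment y z \<subseteq> poly_region vs"
proof -
  define w where "w = vs ! 1 - vs ! 0"
  have len: "1 < length vs" "0 < length vs" using vs(2) by auto
  then have w: "w \<noteq> 0" using nth_eq_iff_index_eq[OF vs(1), of 1 0] by (simp add: w_def)
  have xh: "x \<in> affine hull set vs" using x by (simp add: poly_inside_iff)
  have vh: "vs ! 0 \<in> affine hull set vs" "vs ! 1 \<in> affine hull set vs"
    using len by (auto intro!: hull_inc nth_mem simp del: length_greater_0_conv)
  have ray: "x + t *\<^sub>R w \<in> affine hull set vs" for t
    unfolding w_def using affine_ray[OF affine_affine_hull xh vh(2,1)] .
  obtain t where t: "t > 0" "x + t *\<^sub>R w \<in> poly_boundary vs"
    "\<And>s. 0 \<le> s \<Longrightarrow> s < t \<Longrightarrow> x + s *\<^sub>R w \<in> poly_inside vs"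
    using ray_hits_boundary[OF x w ray] by blast
  have w': "- w \<noteq> 0" and ray': "x + t *\<^sub>R (- w) \<in> affine hull set vs" for t
    using w ray[of "- t"] by simp_all
  obtain t' where t': "t' > 0" "x + t' *\<^sub>R (- w) \<in> poly_boundary vs"
    "\<And>s. 0 \<le> s \<Longrightarrow> s < t' \<Longrightarrow> x + s *\<^sub>R (- w) \<in> poly_inside vs"
    using ray_hits_boundary[OF x w' ray'] by blast
  have line: "x + s *\<^sub>R w \<in> poly_region vs" if "- t' \<le> s" "s \<le> t" for s
  proof (cases "s = t \<or> s = - t'")
    case True
    then show ?thesis using t t' by (auto simp: poly_region_eq)
  next
    case False
    then show ?thesis using t(3)[of s] t'(3)[of "- s"] that by (cases "0 \<le> s") (auto simp: poly_region_eq)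
  qed
  have seg: "closed_segment (x + (- t') *\<^sub>R w) (x + t *\<^sub>R w) = (\<lambda>s. x + s *\<^sub>R w) ` {- t'..t}"
  proof -
    have "(\<lambda>s. x + s *\<^sub>R w) ` closed_segment (- t') t = closed_segment (x + (- t') *\<^sub>R w) (x + t *\<^sub>R w)"
      using closed_segment_linear_image[of "\<lambda>s. s *\<^sub>R w" "- t'" t] closed_segment_translation[of x "(- t') *\<^sub>R w" "t *\<^sub>R w"]
      by (simp add: image_image linear_scaleR_left)
    then show ?thesis using t t' by (simp add: closed_segment_eq_real_ivl)
  qed
  show ?thesis
  proof (rule that)
    show "x + (- t') *\<^sub>R w \<in> poly_boundary vs" using t' by simp
    show "x \<in> closed_segment (x + (- t') *\<^sub>R w) (x + t *\<^sub>R w)"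
      unfolding seg using t t' by (intro image_eqI[of _ _ 0]) auto
    show "closed_segment (x + (- t') *\<^sub>R w) (x + t *\<^sub>R w) \<subseteq> poly_region vs"
      unfolding seg using line by auto
  qed (rule t)
qed

lemma disc_subset_region:
  assumes "star_shaped_wrt_disc vs c \<rho>" "poly_region vs \<noteq> {}"
  shows "ball c \<rho> \<inter> affine hull set vs \<subseteq> poly_region vs"
proof
  fix y assume y: "y \<in> ball c \<rho> \<inter> affine hull set vs"
  obtain x where "x \<in> poly_region vs" using assms by blast
  then have "closed_segment y x \<subseteq> poly_region vs" using assms(1) y by (simp add: star_shaped_wrt_disc_def)
  then show "y \<in> poly_region vs" by auto
qed

text \<open>The frame is an orthonormal basis of the direction space, which does not depend on the
  base point; so \<open>c\<close> may later be the centre of the disc.\<close>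

lemma plane_frame:
  assumes "simple_flat_polygon vs"
  obtains e1 e2 where "norm e1 = 1" "norm e2 = 1" "e1 \<bullet> e2 = 0"
    "\<And>c. c \<in> affine hull set vs \<Longrightarrow> affine hull set vs = range (\<lambda>(s, t). c + s *\<^sub>R e1 + t *\<^sub>R e2)"
proof -
  have dim2: "aff_dim (set vs) = 2" using assms by (simp add: simple_flat_polygon_def)
  then have ne: "set vs \<noteq> {}" by auto
  then obtain b where b: "b \<in> affine hull set vs" by (metis ex_in_conv hull_inc)
  define V where "V = (\<lambda>x. x - b) ` (affine hull set vs)"
  have V: "subspace V"
    using affine_diffs_subspace_subtract[OF affine_affine_hull b] by (simp add: V_def)
  have "int (dim V) = 2"
    using aff_dim_eq_dim_subtract[OF b[THEN hull_inc]] dim2 by (simp add: V_def hull_hull)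
  then have dimV: "dim V = 2" by simp
  obtain B where B: "B \<subseteq> V" "pairwise orthogonal B" "\<And>x. x \<in> B \<Longrightarrow> norm x = 1" "independent B"
     "card B = dim V" "span B = V"
    using orthonormal_basis_subspace[OF V] by blast
  obtain e1 e2 where e: "B = {e1, e2}" "e1 \<noteq> e2" using B(5) dimV by (auto simp: card_2_iff)
  have "affine hull set vs = range (\<lambda>(s, t). c + s *\<^sub>R e1 + t *\<^sub>R e2)" if c: "c \<in> affine hull set vs" for c
  proof -
    have sp: "V = range (\<lambda>(s, t). s *\<^sub>R e1 + t *\<^sub>R e2)"
    proof -
      have "v \<in> V \<longleftrightarrow> (\<exists>s t. v = s *\<^sub>R e1 + t *\<^sub>R e2)" for v
        unfolding B(6)[symmetric] e(1) span_breakdown_eq span_empty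
        by (metis (no_types, lifting) add.commute add.right_neutral diff_add_cancel diff_diff_eq eq_iff_diff_eq_0 singletonD singletonI)
      then show ?thesis by (auto simp: image_iff case_prod_beta)
    qed
    have "affine hull set vs = (+) c ` V"
    proof -
      have "V = (\<lambda>x. x - c) ` (affine hull set vs)"
      proof -
        have "x - b \<in> (\<lambda>x. x - c) ` (affine hull set vs)" if "x \<in> affine hull set vs" for x
          using affine_ray[OF affine_affine_hull that c b, of 1] by (intro image_eqI[of _ _ "x + (c - b)"]) auto
        moreover have "x - c \<in> (\<lambda>x. x - b) ` (affine hull set vs)" if "x \<in> affine hull set vs" for x
          using affine_ray[OF affine_affine_hull that b c, of 1] by (intro image_eqI[of _ _ "x + (b - c)"]) auto
        ultimately show ?thesis unfolding V_def by blast
      qed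
      then show ?thesis by (simp add: image_image)
    qed
    then show ?thesis unfolding sp by (auto simp: image_image algebra_simps case_prod_beta)
  qed
  moreover have "e1 \<bullet> e2 = 0" using B(2) e by (auto simp: pairwise_def orthogonal_def)
  ultimately show ?thesis using that[of e1 e2] B(3) e by auto
qed

subsection \<open>Distance and normal on an element\<close>

context fermi begin

text \<open>A vertex lies both on \<Gamma> and in the element. This first-order bound makes the
  derivatives of the projection available on the whole element.\<close>

lemma element_sd_le_diameter:
  assumes vs: "simple_flat_polygon vs" "set vs \<subseteq> \<Gamma>" "poly_region vs \<subseteq> U" and x: "x \<in> poly_region vs"
  shows "\<bar>sd x\<bar> \<le> diameter (poly_region vs)"
proof -
  have "vs \<noteq> []" using vs(1) by (auto simp: simple_flat_polygon_def)
  then have v: "hd vs \<in> \<Gamma>" "hd vs \<in> poly_region vs"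
    using vs(2) vertex_in_boundary[of "hd vs" vs] by (auto simp: poly_region_eq)
  have "\<bar>sd x\<bar> = infdist x \<Gamma>" using decomposition(3) x vs(3) by blast
  also have "\<dots> \<le> dist x (hd vs)" by (rule infdist_le[OF v(1)])
  also have "\<dots> \<le> diameter (poly_region vs)"
    using diameter_bounded_bound[OF bounded_poly_region x v(2)] .
  finally show ?thesis .
qed

lemma element_small:
  assumes vs: "simple_flat_polygon vs" "set vs \<subseteq> \<Gamma>" "poly_region vs \<subseteq> U"
    and small: "\<kappa> * diameter (poly_region vs) \<le> 1/2" and x: "x \<in> poly_region vs"
  shows "\<kappa> * \<bar>sd x\<bar> \<le> 1/2"
proof -
  have "\<kappa> * \<bar>sd x\<bar> \<le> \<kappa> * diameter (poly_region vs)"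
    using element_sd_le_diameter[OF vs x] kappa_ge_1 by (intro mult_left_mono) auto
  then show ?thesis using small by linarith
qed

text \<open>The factor 4 is 2 + 2: one interpolation on an edge, whose endpoints are zeros of
  \<open>sd\<close>, and one on a chord, whose endpoints carry the bound for the edges.\<close>

lemma element_sd_bound:
  assumes vs: "simple_flat_polygon vs" "set vs \<subseteq> \<Gamma>" "poly_region vs \<subseteq> U"
    and small: "\<kappa> * diameter (poly_region vs) \<le> 1/2" and x: "x \<in> poly_region vs"
  shows "\<bar>sd x\<bar> \<le> 4 * \<kappa> * (diameter (poly_region vs))\<^sup>2"
proof -
  define H where "H = diameter (poly_region vs)"
  have H: "dist y z \<le> H" if "y \<in> poly_region vs" "z \<in> poly_region vs" for y z
    using diameter_bounded_bound[OF bounded_poly_region that] by (simp add: H_def)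
  have smallE: "\<kappa> * \<bar>sd y\<bar> \<le> 1/2" if "y \<in> poly_region vs" for y
    using element_small[OF vs small that] .
  have interp: "\<bar>sd w\<bar> \<le> m + 2 * \<kappa> * H\<^sup>2"
    if seg: "closed_segment y z \<subseteq> poly_region vs" and w: "w \<in> closed_segment y z"
      and m: "\<bar>sd y\<bar> \<le> m" "\<bar>sd z\<bar> \<le> m" for w y z m
  proof -
    have "\<bar>sd w\<bar> \<le> m + 2 * \<kappa> * (dist y z)\<^sup>2"
      using seg vs(3) smallE by (intro sd_segment_interpolation w m) auto
    also have "\<dots> \<le> m + 2 * \<kappa> * H\<^sup>2"
      using seg kappa_ge_1 H[of y z] by (intro add_left_mono mult_left_mono power_mono) auto
    finally show ?thesis .
  qed
  have bd: "\<bar>sd y\<bar> \<le> 2 * \<kappa> * H\<^sup>2" if y: "y \<in> poly_boundary vs" for y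
  proof -
    obtain i where i: "i < length vs" "y \<in> poly_edge vs i" using y by (auto simp: poly_boundary_def)
    have vert: "vs ! i \<in> set vs" "vs ! (Suc i mod length vs) \<in> set vs"
      using i by (auto intro!: nth_mem mod_less_divisor elim: order.strict_trans1[rotated])
    have zero: "sd v = 0" if "v \<in> set vs" for v
      using that vs vertex_in_boundary[of v vs] by (intro sd_on_surface) (auto simp: poly_region_eq)
    have "poly_edge vs i \<subseteq> poly_region vs"
      using i by (auto simp: poly_region_eq poly_boundary_def)
    then have "\<bar>sd y\<bar> \<le> 0 + 2 * \<kappa> * H\<^sup>2"
      using i zero vert by (intro interp) (auto simp: poly_edge_def)
    then show ?thesis by simp
  qed
  have "\<kappa> * H\<^sup>2 \<ge> 0" using kappa_ge_1 by simp
  show ?thesis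
  proof (cases "x \<in> poly_boundary vs")
    case True
    then show ?thesis using bd[OF True] \<open>\<kappa> * H\<^sup>2 \<ge> 0\<close> unfolding H_def[symmetric] by linarith
  next
    case False
    then have "x \<in> poly_inside vs" using x by (simp add: poly_inside_def)
    then obtain y z where yz: "y \<in> poly_boundary vs" "z \<in> poly_boundary vs" "x \<in> closed_segment y z"
      "closed_segment y z \<subseteq> poly_region vs"
      using chord_through_inside[of x vs] vs(1) by (auto simp: simple_flat_polygon_def)
    then have "\<bar>sd x\<bar> \<le> 2 * \<kappa> * H\<^sup>2 + 2 * \<kappa> * H\<^sup>2" by (intro interp[of y z] bd) auto
    then show ?thesis unfolding H_def[symmetric] by simp
  qed
qed

text \<open>Expanding \<open>sd\<close> from \<open>c\<close> to \<open>c + r *\<^sub>R e\<close>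
  isolates r (\<nu> \<bullet> e), up to 8 \<kappa> H^2 from the values of \<open>sd\<close> and 2
  \<kappa> r^2 from the remainder. Division by r = \<gamma> H / 2 gives \<kappa> (16 / \<gamma> +
  \<gamma>) H, and passing from \<open>c\<close> to \<open>x\<close> adds 2 \<kappa> H.
  Star-shapedness keeps both segments in the element.\<close>

lemma element_normal_tilt:
  assumes vs: "simple_flat_polygon vs" "set vs \<subseteq> \<Gamma>" "poly_region vs \<subseteq> U"
    and small: "\<kappa> * diameter (poly_region vs) \<le> 1/2"
    and star: "star_shaped_wrt_disc vs c \<rho>" "\<gamma> * diameter (poly_region vs) \<le> \<rho>" "0 < \<gamma>"
    and e: "norm e = 1" "\<And>t. c + t *\<^sub>R e \<in> affine hull set vs"
    and x: "x \<in> poly_region vs"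
  shows "\<bar>\<nu> (foot x) \<bullet> e\<bar> \<le> \<kappa> * (16 / \<gamma> + \<gamma> + 2) * diameter (poly_region vs)"
proof -
  define H where "H = diameter (poly_region vs)"
  have smallE: "\<kappa> * \<bar>sd y\<bar> \<le> 1/2" if "y \<in> poly_region vs" for y
    using element_small[OF vs small that] .
  have disc: "ball c \<rho> \<inter> affine hull set vs \<subseteq> poly_region vs"
    using x by (intro disc_subset_region[OF star(1)]) auto
  have c: "c \<in> affine hull set vs" "\<rho> > 0" using star(1) by (auto simp: star_shaped_wrt_disc_def)
  have cE: "c \<in> poly_region vs" using disc c by auto
  have Hpos: "H > 0"
  proof -
    have "3 \<le> length vs" "distinct vs" using vs(1) by (auto simp: simple_flat_polygon_def)
    then have len: "0 < length vs" "1 < length vs" by linarith+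
    have "vs ! 0 \<noteq> vs ! 1" using nth_eq_iff_index_eq[OF \<open>distinct vs\<close> len] by simp
    moreover have "dist (vs ! 0) (vs ! 1) \<le> H" unfolding H_def
      using len vertex_in_boundary[OF nth_mem]
      by (intro diameter_bounded_bound bounded_poly_region) (auto simp: poly_region_eq)
    ultimately show ?thesis by (metis dual_order.strict_trans1 zero_less_dist_iff)
  qed
  \<comment> \<open>Half of the guaranteed radius, so that \<open>y\<close> lies in the open disc.
    It has to be of the order of H, or division by r would lose a power of H.\<close>
  define r where "r = \<gamma> * H / 2"
  have "\<gamma> * H > 0" using star(3) Hpos by simp
  then have r: "r > 0" "r < \<rho>" using star(2) unfolding r_def H_def[symmetric] by linarith+
  define y where "y = c + r *\<^sub>R e"
  have cy: "dist c y = r" using r e by (simp add: y_def dist_norm)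
  then have yE: "y \<in> poly_region vs" using disc r e(2)[of r] by (auto simp: y_def[symmetric])
  have star_seg: "closed_segment c z \<subseteq> poly_region vs" if "z \<in> poly_region vs" for z
    using star(1) c that by (auto simp: star_shaped_wrt_disc_def)
  have "\<bar>sd y - sd c - \<nu> (foot c) \<bullet> (y - c)\<bar> \<le> 2 * \<kappa> * r\<^sup>2"
    using sd_segment_expansion[OF order_trans[OF star_seg[OF yE] vs(3)] smallE[OF subsetD[OF star_seg[OF yE]]]]
    unfolding cy .
  moreover have "\<bar>sd y\<bar> \<le> 4 * \<kappa> * H\<^sup>2" "\<bar>sd c\<bar> \<le> 4 * \<kappa> * H\<^sup>2"
    using element_sd_bound[OF vs small] yE cE by (auto simp: H_def)
  moreover have "\<nu> (foot c) \<bullet> (y - c) = r * (\<nu> (foot c) \<bullet> e)" by (simp add: y_def)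
  ultimately have "\<bar>r * (\<nu> (foot c) \<bullet> e)\<bar> \<le> 8 * \<kappa> * H\<^sup>2 + 2 * \<kappa> * r\<^sup>2" by linarith
  moreover have "8 * \<kappa> * H\<^sup>2 + 2 * \<kappa> * r\<^sup>2 = r * (\<kappa> * (16 / \<gamma> + \<gamma>) * H)"
    using star(3) by (simp add: r_def power2_eq_square distrib_left distrib_right)
  moreover have "\<bar>r * (\<nu> (foot c) \<bullet> e)\<bar> = r * \<bar>\<nu> (foot c) \<bullet> e\<bar>" using r by (simp add: abs_mult)
  ultimately have "r * \<bar>\<nu> (foot c) \<bullet> e\<bar> \<le> r * (\<kappa> * (16 / \<gamma> + \<gamma>) * H)" by (simp only:)
  then have at_c: "\<bar>\<nu> (foot c) \<bullet> e\<bar> \<le> \<kappa> * (16 / \<gamma> + \<gamma>) * H" using r by simp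
  have "norm (\<nu> (foot x) - \<nu> (foot c)) \<le> 2 * \<kappa> * dist c x"
    by (rule normal_segment_bound[OF order_trans[OF star_seg[OF x] vs(3)] smallE[OF subsetD[OF star_seg[OF x]]]])
  also have "\<dots> \<le> 2 * \<kappa> * H"
    using diameter_bounded_bound[OF bounded_poly_region cE x] kappa_ge_1 by (simp add: H_def)
  finally have "norm (\<nu> (foot x) - \<nu> (foot c)) * norm e \<le> 2 * \<kappa> * H" using e by simp
  then have "\<bar>(\<nu> (foot x) - \<nu> (foot c)) \<bullet> e\<bar> \<le> 2 * \<kappa> * H"
    using Cauchy_Schwarz_ineq2 order_trans by blast
  then have "\<bar>\<nu> (foot x) \<bullet> e\<bar> \<le> 2 * \<kappa> * H + \<kappa> * (16 / \<gamma> + \<gamma>) * H"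
    using at_c by (simp add: inner_diff_left)
  then show ?thesis unfolding H_def[symmetric] by (simp add: algebra_simps)
qed

end

section \<open>Linear algebra of frames, tangential projections and cross products\<close>

text \<open>With \<open>m\<close> the normal of an element and \<open>e1\<close>, \<open>e2\<close>
  its frame, this converts bounds for \<open>n \<bullet> e1\<close> and
  \<open>n \<bullet> e2\<close>, for a unit vector \<open>n\<close>, into one for 1 - (n \<bullet>
  m)^2, the squared length of the tangential part of \<open>m\<close>.\<close>

lemma orthonormal_parseval:
  fixes e1 e2 m n :: "real^3"
  assumes "norm e1 = 1" "norm e2 = 1" "e1 \<bullet> e2 = 0" "norm m = 1" "m \<bullet> e1 = 0" "m \<bullet> e2 = 0"
  shows "(norm n)\<^sup>2 = (n \<bullet> e1)\<^sup>2 + (n \<bullet> e2)\<^sup>2 + (n \<bullet> m)\<^sup>2"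
proof -
  have ne: "e1 \<noteq> e2" "e1 \<noteq> m" "e2 \<noteq> m" using assms by (auto simp: norm_eq_1 inner_commute)
  let ?B = "{e1, e2, m}"
  have orth: "pairwise orthogonal ?B" using assms by (auto simp: pairwise_def orthogonal_def inner_commute)
  have "0 \<notin> ?B" using assms by auto
  then have "independent ?B" using orth pairwise_orthogonal_independent by blast
  moreover have "card ?B = DIM(real^3)" using ne by simp
  ultimately have "span ?B = UNIV"
    using card_ge_dim_independent[of ?B UNIV] by (simp add: top.extremum_unique)
  then have "(\<Sum>i\<in>?B. (n \<bullet> i) *\<^sub>R i) = n"
    using orth assms by (intro orthonormal_basis_expand) auto
  then have "n = (n \<bullet> e1) *\<^sub>R e1 + (n \<bullet> e2) *\<^sub>R e2 + (n \<bullet> m) *\<^sub>R m" using ne by (simp add: add.assoc)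
  then have "n \<bullet> n = n \<bullet> ((n \<bullet> e1) *\<^sub>R e1 + (n \<bullet> e2) *\<^sub>R e2 + (n \<bullet> m) *\<^sub>R m)" by simp
  then show ?thesis unfolding power2_norm_eq_inner by (simp add: inner_add_right power2_eq_square)
qed

text \<open>By the Lagrange identity the left side is (1 - a^2) (1 - b^2) - a^2 b^2 with a = n
  \<bullet> e1 and b = n \<bullet> e2. It is the squared area factor of the orthogonal projection
  onto the plane normal to \<open>n\<close>; being quadratic in the tilt, its deviation from 1 is
  O(h^2).\<close>

lemma norm_cross3_tproj:
  fixes e1 e2 n :: "real^3"
  assumes "norm e1 = 1" "norm e2 = 1" "e1 \<bullet> e2 = 0" "norm n = 1"
  shows "(norm (cross3 (tproj n e1) (tproj n e2)))\<^sup>2 = 1 - (n \<bullet> e1)\<^sup>2 - (n \<bullet> e2)\<^sup>2"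
proof -
  have 1: "e1 \<bullet> e1 = 1" "e2 \<bullet> e2 = 1" "n \<bullet> n = 1" using assms by (auto simp: norm_eq_1)
  have sq: "(norm (tproj n e1))\<^sup>2 = 1 - (n \<bullet> e1)\<^sup>2" "(norm (tproj n e2))\<^sup>2 = 1 - (n \<bullet> e2)\<^sup>2"
    "tproj n e1 \<bullet> tproj n e2 = - (n \<bullet> e1) * (n \<bullet> e2)"
    using assms(3) 1 unfolding power2_norm_eq_inner
    by (simp_all add: tproj_def inner_diff_left inner_diff_right inner_commute[of e1 n] inner_commute[of e2 n] power2_eq_square)
  show ?thesis unfolding norm_cross sq by (simp add: power2_eq_square algebra_simps)
qed

lemma norm_tproj_square:
  assumes "norm n = 1" "norm m = 1" shows "(norm (tproj n m))\<^sup>2 = 1 - (n \<bullet> m)\<^sup>2"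
  using assms unfolding power2_norm_eq_inner
  by (simp add: tproj_def norm_eq_1 inner_diff_left inner_diff_right inner_commute[of m n] power2_eq_square)

lemma norm_cross3_diff_le:
  "norm (cross3 a b - cross3 a' b') \<le> norm (a - a') * norm b + norm a' * norm (b - b')"
proof -
  have le: "norm (cross3 u v) \<le> norm u * norm v" for u v :: "real^3"
  proof (rule power2_le_imp_le)
    show "(norm (cross3 u v))\<^sup>2 \<le> (norm u * norm v)\<^sup>2"
      unfolding norm_cross power_mult_distrib by simp
  qed simp
  have "cross3 a b - cross3 a' b' = cross3 (a - a') b + cross3 a' (b - b')"
    by (simp add: bilinear_lsub[OF bilinear_cross] bilinear_rsub[OF bilinear_cross])
  then show ?thesis using le[of "a - a'" b] le[of a' "b - b'"]
    using norm_triangle_ineq[of "cross3 (a - a') b" "cross3 a' (b - b')"] by simp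
qed

subsection \<open>Continuity of the derivative of the projection\<close>

lemma tendsto_matrix_vector_mult:
  fixes A :: "'a \<Rightarrow> real^'n^'m"
  assumes "(A \<longlongrightarrow> A0) F" "(w \<longlongrightarrow> w0) F"
  shows "((\<lambda>x. A x *v w x) \<longlongrightarrow> A0 *v w0) F"
  unfolding matrix_vector_mult_def by (intro tendsto_intros assms)

lemma tendsto_tproj:
  assumes "(n \<longlongrightarrow> n0) F" "(w \<longlongrightarrow> w0) F"
  shows "((\<lambda>x. tproj (n x) (w x)) \<longlongrightarrow> tproj n0 w0) F"
  unfolding tproj_def by (intro tendsto_intros assms)

context fermi begin

text \<open>Differentiating \<open>norm g *\<^sub>R \<nu> = g\<close> along the projection: the derivative of \<open>norm g\<close> only
  contributes in the normal direction.\<close>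

lemma tproj_Dnormal:
  assumes x: "x \<in> U" and small: "\<kappa> * \<bar>sd x\<bar> \<le> 1/2"
    and W: "open W" "foot x \<in> W" "\<And>q. q \<in> \<Gamma> \<Longrightarrow> q \<in> W \<Longrightarrow> g q \<noteq> 0"
      "\<And>q. q \<in> \<Gamma> \<Longrightarrow> q \<in> W \<Longrightarrow> \<nu> q = (1 / norm (g q)) *\<^sub>R g q"
    and g: "(g has_derivative (\<lambda>v. G *v v)) (at (foot x))"
  shows "tproj (\<nu> (foot x)) (Dnormal x v) = (1 / norm (g (foot x))) *\<^sub>R tproj (\<nu> (foot x)) (G *v Dfoot x v)"
proof -
  define n where "n = \<nu> (foot x)"
  have p: "foot x \<in> \<Gamma>" using decomposition(1)[OF x] .
  have n: "norm n = 1" using norm_normal[OF p] by (simp add: n_def)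
  have gp: "g (foot x) \<noteq> 0" using W p by blast
  have dg: "((\<lambda>y. g (foot y)) has_derivative (\<lambda>v. G *v Dfoot x v)) (at x)"
    using has_derivative_compose[OF foot_has_Dfoot[OF x small] g] .
  define l where "l = (\<lambda>v. sgn (g (foot x)) \<bullet> (G *v Dfoot x v))"
  have dl: "((\<lambda>y. norm (g (foot y))) has_derivative l) (at x)"
    using has_derivative_compose[OF dg has_derivative_norm[OF gp]] by (simp add: l_def inner_commute)
  have "((\<lambda>y. norm (g (foot y)) *\<^sub>R ext_normal \<Gamma> \<nu> y) has_derivative
      (\<lambda>v. norm (g (foot x)) *\<^sub>R Dnormal x v + l v *\<^sub>R ext_normal \<Gamma> \<nu> x)) (at x)"
    using dl normal_has_Dnormal[OF x small] by (rule has_derivative_scaleR)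
  \<comment> \<open>The identity is known on \<Gamma> only; composed with the projection it holds on
    a full neighbourhood of \<open>x\<close> and can be differentiated there.\<close>
  moreover have "\<forall>\<^sub>F y in nhds x. norm (g (foot y)) *\<^sub>R ext_normal \<Gamma> \<nu> y = g (foot y)"
  proof -
    have "filterlim foot (nhds (foot x)) (nhds x)"
      using isCont_foot[OF x] by (simp add: isCont_def tendsto_at_iff_tendsto_nhds)
    then have "\<forall>\<^sub>F y in nhds x. foot y \<in> W" using W(1,2) by (rule topological_tendstoD)
    moreover have "\<forall>\<^sub>F y in nhds x. y \<in> U" using open_U x by (rule eventually_nhds_in_open)
    ultimately show ?thesis
    proof eventually_elim
      case (elim y)
      then have "foot y \<in> \<Gamma>" using decomposition(1) by blast
      then show ?case using W(3,4) elim by (simp add: ext_normal_def)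
    qed
  qed
  then obtain S where S: "open S" "x \<in> S"
      "\<And>y. y \<in> S \<Longrightarrow> norm (g (foot y)) *\<^sub>R ext_normal \<Gamma> \<nu> y = g (foot y)"
    unfolding eventually_nhds by blast
  ultimately have "((\<lambda>y. g (foot y)) has_derivative
      (\<lambda>v. norm (g (foot x)) *\<^sub>R Dnormal x v + l v *\<^sub>R ext_normal \<Gamma> \<nu> x)) (at x)"
    by (rule has_derivative_transform_within_open)
  then have "(\<lambda>v. norm (g (foot x)) *\<^sub>R Dnormal x v + l v *\<^sub>R ext_normal \<Gamma> \<nu> x) = (\<lambda>v. G *v Dfoot x v)"
    using dg by (rule has_derivative_unique)
  then have "G *v Dfoot x v = norm (g (foot x)) *\<^sub>R Dnormal x v + l v *\<^sub>R n"
    by (simp add: fun_eq_iff ext_normal_def n_def)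
  moreover have "tproj n n = 0" using n by (simp add: tproj_def norm_eq_1)
  ultimately have "tproj n (G *v Dfoot x v) = norm (g (foot x)) *\<^sub>R tproj n (Dnormal x v)"
    by (simp add: linear_add[OF linear_tproj] linear_cmul[OF linear_tproj])
  then show ?thesis using gp by (simp add: n_def)
qed

text \<open>The derivative of \<open>\<nu>\<close> within \<open>\<Gamma>\<close> is replaced in the equation for \<open>Dfoot\<close> by the second
  derivative \<open>G\<close> of a defining function, which is continuous by assumption.\<close>

lemma tendsto_Dfoot:
  defines "X \<equiv> {x \<in> U. \<kappa> * \<bar>sd x\<bar> \<le> 1/2}"
  assumes x0: "x0 \<in> X"
  shows "((\<lambda>x. Dfoot x e) \<longlongrightarrow> Dfoot x0 e) (at x0 within X)"
proof -
  define p where "p = foot x0"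
  have x0U: "x0 \<in> U" and small0: "\<kappa> * \<bar>sd x0\<bar> \<le> 1/2" using x0 by (auto simp: X_def)
  have p: "p \<in> \<Gamma>" using decomposition(1)[OF x0U] by (simp add: p_def)
  obtain W f g where W: "open W" "p \<in> W" "C2_on W f g"
    "\<And>x. x \<in> \<Gamma> \<Longrightarrow> x \<in> W \<Longrightarrow> g x \<noteq> 0" "\<And>x. x \<in> \<Gamma> \<Longrightarrow> x \<in> W \<Longrightarrow> \<nu> x = (1 / norm (g x)) *\<^sub>R g x"
    by (rule local_defining_function[OF p]) blast
  obtain G where G: "continuous_on W G" "\<And>q. q \<in> W \<Longrightarrow> (g has_derivative (\<lambda>v. G q *v v)) (at q)"
    using W(3) unfolding C2_on_def by blast
  let ?F = "at x0 within X"
  have foot: "(foot \<longlongrightarrow> p) ?F"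
    using isCont_foot[OF x0U] unfolding isCont_def p_def by (rule tendsto_within_subset) simp
  have sd: "(sd \<longlongrightarrow> sd x0) ?F"
    using isCont_sd[OF x0U] unfolding isCont_def by (rule tendsto_within_subset) simp
  have nu: "((\<lambda>x. \<nu> (foot x)) \<longlongrightarrow> \<nu> p) ?F"
    using isCont_normal_foot[OF x0U] unfolding isCont_def p_def by (rule tendsto_within_subset) simp
  have "isCont g p" using G(2)[OF W(2)] has_derivative_continuous by blast
  then have g: "((\<lambda>x. g (foot x)) \<longlongrightarrow> g p) ?F" using foot by (rule isCont_tendsto_compose)
  have "isCont G p" using G(1) W(1,2) by (simp add: continuous_on_eq_continuous_at)
  then have GG: "((\<lambda>x. G (foot x)) \<longlongrightarrow> G p) ?F" using foot by (rule isCont_tendsto_compose)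
  have gp: "norm (g p) \<noteq> 0" using W(2,4) p by simp
  \<comment> \<open>On tangent vectors \<open>B x\<close> agrees with the operator \<open>M\<close>
    of \<open>foot_has_derivative\<close>, but all its coefficients converge as \<open>x\<close>
    tends to \<open>x0\<close>.\<close>
  define B where "B = (\<lambda>x w. w + sd x *\<^sub>R (1 / norm (g (foot x))) *\<^sub>R tproj (\<nu> (foot x)) (G (foot x) *v w))"
  define z where "z = (\<lambda>x. Dfoot x e)"
  \<comment> \<open>A tangential comparison vector: \<open>z x0\<close> need not be tangent at
    \<open>foot x\<close>, while the lower bound for \<open>B x\<close> is available on tangent
    vectors only.\<close>
  define w where "w = (\<lambda>x. tproj (\<nu> (foot x)) (z x0))"
  have Bz: "B x (Dfoot x v) = tproj (\<nu> (foot x)) v"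
    and Blow: "\<nu> (foot x) \<bullet> u = 0 \<Longrightarrow> norm u \<le> 2 * norm (B x u)"
    if x: "x \<in> X" "foot x \<in> W" for x u v
  proof -
    have xU: "x \<in> U" and small: "\<kappa> * \<bar>sd x\<bar> \<le> 1/2" using x by (auto simp: X_def)
    have eq: "B x (Dfoot x v) = Dfoot x v + sd x *\<^sub>R tproj (\<nu> (foot x)) (Dnormal x v)" for v
      unfolding B_def using tproj_Dnormal[OF xU small W(1) x(2) W(4,5) G(2)[OF x(2)]] by simp
    show "B x (Dfoot x v) = tproj (\<nu> (foot x)) v"
      unfolding eq by (rule Dfoot_equation[OF xU small])
    assume "\<nu> (foot x) \<bullet> u = 0"
    then obtain v where v: "Dfoot x v = u" using Dfoot_onto[OF xU small] by blast
    have "norm (sd x *\<^sub>R tproj (\<nu> (foot x)) (Dnormal x v)) \<le> \<bar>sd x\<bar> * (\<kappa> * norm u)"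
      using norm_tproj_le[OF norm_normal[OF decomposition(1)[OF xU]], of "Dnormal x v"]
        norm_Dnormal_le[OF xU small, of v] v by (auto intro!: mult_left_mono)
    also have "\<dots> \<le> (1/2) * norm u"
      using mult_right_mono[OF small norm_ge_zero[of u]] by (simp add: algebra_simps)
    finally have half: "norm (sd x *\<^sub>R tproj (\<nu> (foot x)) (Dnormal x v)) \<le> (1/2) * norm u" .
    have "norm u \<le> norm (B x u) + norm (sd x *\<^sub>R tproj (\<nu> (foot x)) (Dnormal x v))"
      using eq[of v] unfolding v by (metis add_diff_cancel_right' norm_triangle_ineq4)
    then show "norm u \<le> 2 * norm (B x u)" using half by simp
  qed
  have Bdiff: "B x (u - v) = B x u - B x v" for x u v
    unfolding B_def by (simp add: matrix_vector_mult_diff_distrib linear_diff[OF linear_tproj] algebra_simps)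
  have W0: "foot x0 \<in> W" using W(2) by (simp add: p_def)
  have z0: "tproj (\<nu> p) (z x0) = z x0"
    using Dfoot_tangent[OF x0U small0] by (simp add: tproj_id z_def p_def)
  have wlim: "(w \<longlongrightarrow> z x0) ?F"
    using tendsto_tproj[OF nu tendsto_const, of "z x0"] unfolding w_def z0 .
  have "((\<lambda>x. B x (w x)) \<longlongrightarrow> z x0 + sd x0 *\<^sub>R (1 / norm (g p)) *\<^sub>R tproj (\<nu> p) (G p *v z x0)) ?F"
    unfolding B_def
    by (intro tendsto_intros wlim sd g gp tendsto_tproj nu tendsto_matrix_vector_mult GG)
  also have "z x0 + sd x0 *\<^sub>R (1 / norm (g p)) *\<^sub>R tproj (\<nu> p) (G p *v z x0) = tproj (\<nu> p) e"
    using Bz[OF x0 W0, of e] by (simp add: B_def z_def p_def)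
  finally have "((\<lambda>x. 2 * norm (tproj (\<nu> (foot x)) e - B x (w x))) \<longlongrightarrow> 2 * norm (tproj (\<nu> p) e - tproj (\<nu> p) e)) ?F"
    by (intro tendsto_intros tendsto_tproj nu)
  then have lim0: "((\<lambda>x. 2 * norm (tproj (\<nu> (foot x)) e - B x (w x))) \<longlongrightarrow> 0) ?F" by simp
  have "\<forall>\<^sub>F x in ?F. norm (z x - w x) \<le> 2 * norm (tproj (\<nu> (foot x)) e - B x (w x))"
  proof -
    have "\<forall>\<^sub>F x in ?F. foot x \<in> W" using foot W(1,2) by (rule topological_tendstoD)
    moreover have "\<forall>\<^sub>F x in ?F. x \<in> X" by (simp add: eventually_at_filter)
    ultimately show ?thesis
    proof eventually_elim
      case (elim x)
      have xU: "x \<in> U" and small: "\<kappa> * \<bar>sd x\<bar> \<le> 1/2" using elim by (auto simp: X_def)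
      have "\<nu> (foot x) \<bullet> (z x - w x) = 0"
        using Dfoot_tangent[OF xU small] tproj_orth[OF norm_normal[OF decomposition(1)[OF xU]]]
        by (simp add: z_def w_def inner_diff_right)
      then have "norm (z x - w x) \<le> 2 * norm (B x (z x - w x))" using Blow elim by blast
      then show ?case using Bz[of x e] elim by (simp add: Bdiff z_def)
    qed
  qed
  then have "((\<lambda>x. z x - w x) \<longlongrightarrow> 0) ?F" using lim0 by (rule Lim_null_comparison)
  from tendsto_add[OF this wlim] show ?thesis by (simp add: z_def)
qed

lemma continuous_on_Dfoot:
  assumes "S \<subseteq> U" "\<And>x. x \<in> S \<Longrightarrow> \<kappa> * \<bar>sd x\<bar> \<le> 1/2"
  shows "continuous_on S (\<lambda>x. Dfoot x e)"
  unfolding continuous_on_def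
  by (rule ballI, rule tendsto_within_subset[OF tendsto_Dfoot]) (use assms in auto)

end

subsection \<open>Surface measures and area densities\<close>

text \<open>Pairing with \<open>f' y\<close> gives a real function with positive derivative at
  \<open>y\<close>, which differs from its value at \<open>y\<close> in a punctured neighbourhood.
  So the zeros of \<open>f\<close> have no limit point in D, and hence are countable.\<close>

lemma countable_zeros_regular_curve:
  fixes f :: "real \<Rightarrow> 'a::real_inner"
  assumes D: "open D" and f: "\<And>s. s \<in> D \<Longrightarrow> (f has_vector_derivative f' s) (at s)" "\<And>s. s \<in> D \<Longrightarrow> f' s \<noteq> 0"
  shows "countable {s \<in> D. f s = 0}"
proof -
  have "{s \<in> D. f s = 0} sparse_in D"
    unfolding sparse_in_open[OF D]
  proof (intro ballI notI)
    fix y assume y: "y \<in> D" "y islimpt {s \<in> D. f s = 0}"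
    obtain g where g: "\<And>n. g n \<in> {s \<in> D. f s = 0} - {y}" "g \<longlonglongrightarrow> y"
      using y(2) unfolding islimpt_sequential by blast
    define k where "k = (\<lambda>s. f' y \<bullet> f s)"
    have k: "(k has_real_derivative f' y \<bullet> f' y) (at y)"
      using has_derivative_inner_right[OF f(1)[OF y(1), unfolded has_vector_derivative_def], of "f' y"]
      by (simp add: k_def has_field_derivative_def mult.commute[of _ "f' y \<bullet> f' y"] mult_commute_abs)
    have pos: "f' y \<bullet> f' y > 0" using f(2)[OF y(1)] by simp
    obtain d1 where d1: "d1 > 0" "\<And>h. 0 < h \<Longrightarrow> h < d1 \<Longrightarrow> k y < k (y + h)"
      using DERIV_pos_inc_right[OF k pos] by blast
    obtain d2 where d2: "d2 > 0" "\<And>h. 0 < h \<Longrightarrow> h < d2 \<Longrightarrow> k (y - h) < k y"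
      using DERIV_pos_inc_left[OF k pos] by blast
    have ne: "k s \<noteq> k y" if "s \<noteq> y" "dist s y < min d1 d2" for s
    proof (cases "s < y")
      case True
      then show ?thesis using d2(2)[of "y - s"] that by (simp add: dist_real_def)
    next
      case False
      then show ?thesis using d1(2)[of "s - y"] that by (simp add: dist_real_def)
    qed
    have "(\<lambda>n. k (g n)) \<longlonglongrightarrow> k y"
      using DERIV_isCont[OF k] g(2) by (rule isCont_tendsto_compose)
    moreover have "k (g n) = 0" for n using g(1)[of n] by (simp add: k_def)
    ultimately have "k y = 0" by (simp add: LIMSEQ_const_iff)
    have "\<forall>\<^sub>F n in sequentially. dist (g n) y < min d1 d2"
      using g(2) d1(1) d2(1) by (intro tendstoD) auto
    then obtain n where "dist (g n) y < min d1 d2" using eventually_happens by force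
    then show False using ne[of "g n"] g(1)[of n] \<open>k y = 0\<close> by (simp add: k_def)
  qed
  then have "countable (D \<inter> {s \<in> D. f s = 0})" by (rule sparse_imp_countable[OF D])
  moreover have "D \<inter> {s \<in> D. f s = 0} = {s \<in> D. f s = 0}" by auto
  ultimately show ?thesis by simp
qed

lemma emeasure_zero_if_countable_slices:
  fixes B :: "(real \<times> real) set"
  assumes B: "B \<in> sets borel"
    and slices: "(\<forall>s. countable {t. (s, t) \<in> B}) \<or> (\<forall>t. countable {s. (s, t) \<in> B})"
  shows "emeasure lborel B = 0"
proof -
  have pair: "(lborel :: (real \<times> real) measure) = lborel \<Otimes>\<^sub>M lborel" by (simp add: lborel_prod)
  have B': "B \<in> sets (lborel \<Otimes>\<^sub>M lborel)" using B unfolding lborel_prod by simp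
  from slices show ?thesis
  proof
    assume c: "\<forall>s. countable {t. (s, t) \<in> B}"
    have "emeasure lborel B = (\<integral>\<^sup>+s. emeasure lborel (Pair s -` B) \<partial>lborel)"
      unfolding pair by (rule lborel.emeasure_pair_measure_alt[OF B'])
    also have "\<dots> = (\<integral>\<^sup>+s. 0 \<partial>(lborel :: real measure))"
      using c by (intro nn_integral_cong) (simp add: emeasure_lborel_countable vimage_def)
    finally show ?thesis by simp
  next
    assume c: "\<forall>t. countable {s. (s, t) \<in> B}"
    have "emeasure lborel B = (\<integral>\<^sup>+t. emeasure lborel ((\<lambda>s. (s, t)) -` B) \<partial>lborel)"
      unfolding pair by (rule lborel_pair.emeasure_pair_measure_alt2[OF B'])
    also have "\<dots> = (\<integral>\<^sup>+s. 0 \<partial>(lborel :: real measure))"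
      using c by (intro nn_integral_cong) (simp add: emeasure_lborel_countable vimage_def)
    finally show ?thesis by simp
  qed
qed

lemma borel_image_open:
  fixes f :: "'a::euclidean_space \<Rightarrow> 'b::euclidean_space"
  assumes "open V" "continuous_on V f" shows "f ` V \<in> sets borel"
proof -
  obtain C :: "nat \<Rightarrow> 'a set" where C: "\<And>n. compact (C n)" "\<And>n. C n \<subseteq> V" "\<Union> (range C) = V"
    using open_Union_compact_subsets[OF assms(1)] by metis
  have "compact (f ` C n)" for n
    using C assms(2) by (intro compact_continuous_image) (auto intro: continuous_on_subset)
  then have "(\<Union>n. f ` C n) \<in> sets borel"
    by (intro sets.countable_UN) (auto intro: borel_compact)
  moreover have "(\<Union>n. f ` C n) = f ` V" using C(3) by blast
  ultimately show ?thesis by simp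
qed

lemma borel_relative_preimage:
  assumes "open V" "continuous_on V f" "B \<in> sets borel"
  shows "{u \<in> V. f u \<in> B} \<in> sets borel"
proof -
  have "f \<in> borel_measurable (restrict_space borel V)"
    using assms(2) by (rule borel_measurable_continuous_on_restrict)
  then have "f -` B \<inter> space (restrict_space borel V) \<in> sets (restrict_space borel V)"
    using assms(3) by (rule measurable_sets)
  then have "f -` B \<inter> V \<in> sets borel"
    using assms(1) by (simp add: space_restrict_space sets_restrict_space_iff)
  moreover have "f -` B \<inter> V = {u \<in> V. f u \<in> B}" by auto
  ultimately show ?thesis by simp
qed

lemma regular_patch_continuous:
  "regular_patch S V \<phi> \<phi>1 \<phi>2 \<Longrightarrow> continuous_on V \<phi>"
  unfolding regular_patch_def by (meson continuous_at_imp_continuous_on has_derivative_continuous)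

text \<open>Where \<phi>1 is not parallel to \<open>v\<close>, the curves s \<mapsto> F (s, t) are
  regular and meet the line in countably many parameters, so Tonelli applies; likewise for \<phi>2
  and the other variable. The two cases cover the patch because \<phi>1 and \<phi>2 cannot both be
  parallel to \<open>v\<close>.\<close>

lemma regular_patch_line_null:
  assumes patch: "regular_patch S V \<phi> \<phi>1 \<phi>2" and v: "v \<noteq> 0"
  shows "{u \<in> V. cross3 v (\<phi> u - c) = 0} \<in> null_sets lborel"
proof -
  have V: "open V" "continuous_on V \<phi>1" "continuous_on V \<phi>2" "continuous_on V \<phi>"
    and der: "\<And>u. u \<in> V \<Longrightarrow> (\<phi> has_derivative (\<lambda>w. fst w *\<^sub>R \<phi>1 u + snd w *\<^sub>R \<phi>2 u)) (at u)"
    and nz: "\<And>u. u \<in> V \<Longrightarrow> cross3 (\<phi>1 u) (\<phi>2 u) \<noteq> 0"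
    using patch regular_patch_continuous[OF patch] by (simp_all add: regular_patch_def)
  define Z where "Z = (\<lambda>\<psi>. {u \<in> V. cross3 v (\<psi> u) \<noteq> 0})"
  define F where "F = (\<lambda>u. cross3 v (\<phi> u - c))"
  have lin: "bounded_linear (cross3 v)"
    using bilinear_cross by (simp add: bilinear_def linear_conv_bounded_linear)
  have openZ: "open (Z \<psi>)" if "continuous_on V \<psi>" for \<psi>
  proof -
    have "continuous_on V (\<lambda>u. cross3 v (\<psi> u))"
      by (intro bounded_linear.continuous_on[OF lin] that)
    then have "open (V \<inter> (\<lambda>u. cross3 v (\<psi> u)) -` (- {0}))"
      using V(1) by (intro continuous_open_preimage) auto
    moreover have "V \<inter> (\<lambda>u. cross3 v (\<psi> u)) -` (- {0}) = Z \<psi>" by (auto simp: Z_def)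
    ultimately show ?thesis by simp
  qed
  have contF: "continuous_on V F"
    unfolding F_def by (intro bounded_linear.continuous_on[OF lin] continuous_intros V)
  have borelF: "{u \<in> Z \<psi>. F u = 0} \<in> sets borel" if "continuous_on V \<psi>" for \<psi>
    using borel_relative_preimage[OF openZ[OF that], of F "{0}"] contF
    by (simp add: Z_def continuous_on_subset[OF contF])
  have dF: "(F has_derivative (\<lambda>w. fst w *\<^sub>R cross3 v (\<phi>1 u) + snd w *\<^sub>R cross3 v (\<phi>2 u))) (at u)" if "u \<in> V" for u
  proof -
    have "((\<lambda>u. \<phi> u - c) has_derivative (\<lambda>w. fst w *\<^sub>R \<phi>1 u + snd w *\<^sub>R \<phi>2 u)) (at u)"
      using der[OF that] by (auto intro!: derivative_eq_intros)
    from bounded_linear.has_derivative[OF lin this] show ?thesis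
      by (simp add: F_def cross_add_right cross_mult_right)
  qed
  have "countable {s. (s, t) \<in> {u \<in> Z \<phi>1. F u = 0}}" for t
  proof -
    have cts: "continuous_on UNIV (\<lambda>s::real. (s, t))" by (intro continuous_intros)
    have "open ((\<lambda>s. (s, t)) -` Z \<phi>1)" using openZ[OF V(2)] cts by (simp add: open_vimage)
    moreover have "((\<lambda>s. F (s, t)) has_vector_derivative cross3 v (\<phi>1 (s, t))) (at s)" if "(s, t) \<in> V" for s
    proof -
      have "((\<lambda>s. (s, t)) has_derivative (\<lambda>h. (h, 0))) (at s)" by (auto intro!: derivative_eq_intros)
      from has_derivative_compose[OF this dF[OF that]] show ?thesis
        by (simp add: has_vector_derivative_def)
    qed
    ultimately have "countable {s \<in> (\<lambda>s. (s, t)) -` Z \<phi>1. F (s, t) = 0}"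
      by (intro countable_zeros_regular_curve) (auto simp: Z_def)
    then show ?thesis by (simp add: vimage_def)
  qed
  then have 1: "{u \<in> Z \<phi>1. F u = 0} \<in> null_sets lborel"
    using emeasure_zero_if_countable_slices[OF borelF[OF V(2)]] borelF[OF V(2)] by (simp add: null_sets_def)
  have "countable {s. (t, s) \<in> {u \<in> Z \<phi>2. F u = 0}}" for t
  proof -
    have cts: "continuous_on UNIV (\<lambda>s::real. (t, s))" by (intro continuous_intros)
    have "open ((\<lambda>s. (t, s)) -` Z \<phi>2)" using openZ[OF V(3)] cts by (simp add: open_vimage)
    moreover have "((\<lambda>s. F (t, s)) has_vector_derivative cross3 v (\<phi>2 (t, s))) (at s)" if "(t, s) \<in> V" for s
    proof -
      have "((\<lambda>s. (t, s)) has_derivative (\<lambda>h. (0, h))) (at s)" by (auto intro!: derivative_eq_intros)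
      from has_derivative_compose[OF this dF[OF that]] show ?thesis
        by (simp add: has_vector_derivative_def)
    qed
    ultimately have "countable {s \<in> (\<lambda>s. (t, s)) -` Z \<phi>2. F (t, s) = 0}"
      by (intro countable_zeros_regular_curve) (auto simp: Z_def)
    then show ?thesis by (simp add: vimage_def)
  qed
  then have 2: "{u \<in> Z \<phi>2. F u = 0} \<in> null_sets lborel"
    using emeasure_zero_if_countable_slices[OF borelF[OF V(3)]] borelF[OF V(3)] by (simp add: null_sets_def)
  have "{u \<in> V. F u = 0} = {u \<in> Z \<phi>1. F u = 0} \<union> {u \<in> Z \<phi>2. F u = 0}"
  proof -
    have "cross3 v (\<phi>1 u) \<noteq> 0 \<or> cross3 v (\<phi>2 u) \<noteq> 0" if u: "u \<in> V" for u
    proof (rule ccontr)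
      assume "\<not> ?thesis"
      then have "collinear {0, v, \<phi>1 u}" "collinear {0, v, \<phi>2 u}" by (auto simp: cross_eq_0)
      then obtain a b where "\<phi>1 u = a *\<^sub>R v" "\<phi>2 u = b *\<^sub>R v"
        using v by (metis collinear_lemma scaleR_zero_left)
      then show False using nz[OF u] by (simp add: cross_mult_left cross_mult_right)
    qed
    then show ?thesis by (auto simp: Z_def)
  qed
  then have "{u \<in> V. F u = 0} \<in> null_sets lborel" using null_sets.Un[OF 1 2] by simp
  then show ?thesis by (simp add: F_def)
qed

text \<open>The detour through the open images \<open>\<phi> n ` V n\<close> avoids the measurability of injective images of
  arbitrary Borel sets.\<close>

lemma surface_measure_line_null:
  assumes M: "surface_measure S M" and v: "v \<noteq> 0"
  shows "{x. cross3 v (x - c) = 0} \<in> null_sets M"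
proof -
  let ?L = "{x. cross3 v (x - c) = 0}"
  have sets_M: "sets M = sets borel" using M by (simp add: surface_measure_def)
  have area: "emeasure M (\<phi> ` B) = (\<integral>\<^sup>+u\<in>B. ennreal (norm (cross3 (\<phi>1 u) (\<phi>2 u))) \<partial>lborel)"
    if "regular_patch S V \<phi> \<phi>1 \<phi>2" "B \<in> sets borel" "B \<subseteq> V" for V \<phi> \<phi>1 \<phi>2 B
    using M that unfolding surface_measure_def by blast
  obtain V \<phi> \<phi>1 \<phi>2 where patch: "\<And>n::nat. regular_patch S (V n) (\<phi> n) (\<phi>1 n) (\<phi>2 n)"
    and rest: "UNIV - (\<Union>n. \<phi> n ` V n) \<in> null_sets M"
    using M unfolding surface_measure_def by blast
  have "closed ?L"
  proof -
    have lin: "bounded_linear (cross3 v)"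
      using bilinear_cross by (simp add: bilinear_def linear_conv_bounded_linear)
    have cts: "continuous_on UNIV (\<lambda>x. cross3 v (x - c))"
      by (intro bounded_linear.continuous_on[OF lin] continuous_intros)
    show ?thesis
      using closed_Collect_eq[OF cts continuous_on_const[of UNIV 0]] by simp
  qed
  then have Lb: "?L \<in> sets borel" by simp
  have n: "?L \<inter> \<phi> n ` V n \<in> null_sets M" for n
  proof (rule null_setsI)
    have V: "open (V n)" "continuous_on (V n) (\<phi> n)"
      using patch[of n] regular_patch_continuous[OF patch[of n]] by (simp_all add: regular_patch_def)
    show "?L \<inter> \<phi> n ` V n \<in> sets M" unfolding sets_M using Lb borel_image_open[OF V] by blast
    let ?B = "{u \<in> V n. cross3 v (\<phi> n u - c) = 0}"
    have B: "?B \<in> null_sets lborel" by (rule regular_patch_line_null[OF patch v])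
    have "?L \<inter> \<phi> n ` V n = \<phi> n ` ?B" by auto
    then have "emeasure M (?L \<inter> \<phi> n ` V n) = (\<integral>\<^sup>+u\<in>?B. ennreal (norm (cross3 (\<phi>1 n u) (\<phi>2 n u))) \<partial>lborel)"
      using area[OF patch, of ?B n] B by (auto simp: null_sets_def)
    also have "\<dots> = 0"
      using B by (simp add: nn_integral_null_set)
    finally show "emeasure M (?L \<inter> \<phi> n ` V n) = 0" .
  qed
  have "(\<Union>n. ?L \<inter> \<phi> n ` V n) \<union> (UNIV - (\<Union>n. \<phi> n ` V n)) \<in> null_sets M"
    using n rest by (intro null_sets.Un null_sets_UN) auto
  then show ?thesis
  proof (rule null_sets_subset)
    show "?L \<in> sets M" using Lb sets_M by simp
  qed auto
qed

lemma surface_measure_segment_null: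
  assumes M: "surface_measure S M"
  shows "closed_segment p q \<in> null_sets M"
proof -
  \<comment> \<open>A degenerate segment gets an arbitrary direction, so that there always is a line
    containing it.\<close>
  define v where "v = (if p = q then axis 1 1 else q - p)"
  have v: "v \<noteq> 0" by (simp add: v_def axis_eq_0_iff)
  have "closed_segment p q \<subseteq> {x. cross3 v (x - p) = 0}"
  proof
    fix x assume "x \<in> closed_segment p q"
    then obtain t where "x = (1 - t) *\<^sub>R p + t *\<^sub>R q" by (auto simp: in_segment)
    then have "x - p = t *\<^sub>R (q - p)" by (simp add: algebra_simps)
    then show "x \<in> {x. cross3 v (x - p) = 0}" by (auto simp: v_def cross_mult_right)
  qed
  then show ?thesis
    using M by (intro null_sets_subset[OF surface_measure_line_null[OF M v]]) (simp_all add: surface_measure_def)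
qed

text \<open>\<phi> preserves area, so \<open>Ah\<close> is Lebesgue measure in the parameters, where
  the area of the image under \<open>a\<close> has density J. As \<delta> is accessible only through
  integrals, the sets where it leaves [1 - \<eta>, 1 + \<eta>] are tested: positive measure would
  give a strict inequality against the bounds for J.\<close>

lemma area_density_bound_on_patch:
  assumes A: "surface_measure S' A" and Ah: "surface_measure S Ah"
    and dens: "area_density a S A Ah \<delta>"
    and \<phi>: "regular_patch S V \<phi> \<phi>1 \<phi>2" "\<And>u. u \<in> V \<Longrightarrow> norm (cross3 (\<phi>1 u) (\<phi>2 u)) = 1" "bounded V"
    and \<psi>: "regular_patch S' V (a \<circ> \<phi>) \<psi>1 \<psi>2" "\<And>u. u \<in> V \<Longrightarrow> \<bar>1 - norm (cross3 (\<psi>1 u) (\<psi>2 u))\<bar> \<le> \<eta>"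
  shows "AE x in Ah. x \<in> \<phi> ` V \<longrightarrow> \<bar>1 - \<delta> x\<bar> \<le> \<eta>"
proof -
  have sets_Ah: "sets Ah = sets borel" using Ah by (simp add: surface_measure_def)
  have V: "open V" "continuous_on V \<phi>" "\<phi> ` V \<subseteq> S"
    using \<phi>(1) regular_patch_continuous[OF \<phi>(1)] by (simp_all add: regular_patch_def)
  have img: "\<phi> ` V \<in> sets borel" using V by (intro borel_image_open)
  define \<delta>' where "\<delta>' = (\<lambda>x. indicator (\<phi> ` V) x *\<^sub>R \<delta> x)"
  have \<delta>: "\<delta> \<in> borel_measurable (restrict_space borel S)" "\<And>x. x \<in> S \<Longrightarrow> 0 \<le> \<delta> x"
    and dens': "\<And>B. B \<in> sets borel \<Longrightarrow> B \<subseteq> S \<Longrightarrow> emeasure A (a ` B) = (\<integral>\<^sup>+x\<in>B. ennreal (\<delta> x) \<partial>Ah)"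
    using dens by (auto simp: area_density_def)
  have "\<delta> \<in> borel_measurable (restrict_space borel (\<phi> ` V))"
    using \<delta>(1) V(3) by (rule measurable_restrict_mono)
  then have meas: "\<delta>' \<in> borel_measurable borel"
    using img unfolding \<delta>'_def by (subst (asm) borel_measurable_restrict_space_iff) auto
  have meas_h: "\<delta>' \<in> borel_measurable Ah" using meas by (simp add: measurable_cong_sets[OF sets_Ah refl])
  have meas_ind: "(\<lambda>x. ennreal (f x) * indicator B x) \<in> borel_measurable Ah"
    if "f \<in> borel_measurable Ah" "B \<in> sets borel" for f B
  proof -
    have [measurable]: "f \<in> borel_measurable Ah" "B \<in> sets Ah" using that sets_Ah by simp_all
    show ?thesis by measurable
  qed
  \<comment> \<open>Here boundedness of \<open>V\<close> enters: the strict comparison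
    \<open>nn_integral_less\<close> asks for a finite integral.\<close>
  have Vfin: "emeasure lborel V < \<infinity>" using \<phi>(3) by (rule emeasure_bounded_finite)
  define J where "J = (\<lambda>u. norm (cross3 (\<psi>1 u) (\<psi>2 u)))"
  have key: "emeasure Ah B = emeasure lborel {u \<in> V. \<phi> u \<in> B}" "emeasure Ah B \<noteq> \<infinity>"
    "(\<integral>\<^sup>+x. ennreal (\<delta>' x) * indicator B x \<partial>Ah) = (\<integral>\<^sup>+u\<in>{u \<in> V. \<phi> u \<in> B}. ennreal (J u) \<partial>lborel)"
    if B: "B \<in> sets borel" "B \<subseteq> \<phi> ` V" for B
  proof -
    let ?B = "{u \<in> V. \<phi> u \<in> B}"
    have B': "?B \<in> sets borel" by (rule borel_relative_preimage[OF V(1,2) B(1)])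
    have Beq: "\<phi> ` ?B = B" using B(2) by auto
    have "emeasure Ah (\<phi> ` ?B) = (\<integral>\<^sup>+u\<in>?B. ennreal (norm (cross3 (\<phi>1 u) (\<phi>2 u))) \<partial>lborel)"
      using Ah \<phi>(1) B' unfolding surface_measure_def by blast
    also have "\<dots> = (\<integral>\<^sup>+u. indicator ?B u \<partial>lborel)"
      using \<phi>(2) by (intro nn_integral_cong) (auto split: split_indicator)
    also have "\<dots> = emeasure lborel ?B" using B' by simp
    finally show eq: "emeasure Ah B = emeasure lborel ?B" unfolding Beq .
    have "emeasure lborel ?B \<le> emeasure lborel V" using V(1) by (intro emeasure_mono) auto
    then show "emeasure Ah B \<noteq> \<infinity>" using Vfin eq by auto
    have "(\<integral>\<^sup>+x. ennreal (\<delta>' x) * indicator B x \<partial>Ah) = (\<integral>\<^sup>+x\<in>B. ennreal (\<delta> x) \<partial>Ah)"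
      using B(2) by (intro nn_integral_cong) (auto simp: \<delta>'_def split: split_indicator)
    also have "\<dots> = emeasure A (a ` B)" using dens'[of B] B V(3) by auto
    also have "a ` B = (a \<circ> \<phi>) ` ?B" using Beq by (metis image_comp)
    also have "emeasure A ((a \<circ> \<phi>) ` ?B) = (\<integral>\<^sup>+u\<in>?B. ennreal (J u) \<partial>lborel)"
      using A \<psi>(1) B' unfolding surface_measure_def J_def by blast
    finally show "(\<integral>\<^sup>+x. ennreal (\<delta>' x) * indicator B x \<partial>Ah) = (\<integral>\<^sup>+u\<in>?B. ennreal (J u) \<partial>lborel)" .
  qed
  have const: "(\<integral>\<^sup>+u\<in>{u \<in> V. \<phi> u \<in> B}. ennreal c \<partial>lborel) = (\<integral>\<^sup>+x. ennreal c * indicator B x \<partial>Ah)"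
    if B: "B \<in> sets borel" "B \<subseteq> \<phi> ` V" for B c
    using key(1)[OF B] borel_relative_preimage[OF V(1,2) B(1)] B(1)
    by (simp add: nn_integral_cmult_indicator sets_Ah)
  have constfin: "(\<integral>\<^sup>+x. ennreal c * indicator B x \<partial>Ah) \<noteq> \<infinity>" if B: "B \<in> sets borel" "B \<subseteq> \<phi> ` V" for B c
    using key(2)[OF B] B(1) by (simp add: nn_integral_cmult_indicator sets_Ah ennreal_mult_eq_top_iff)
  have upper: "AE x in Ah. x \<in> \<phi> ` V \<longrightarrow> \<delta> x \<le> 1 + \<eta>"
  proof -
    define B where "B = {x \<in> \<phi> ` V. 1 + \<eta> < \<delta>' x}"
    have B: "B \<in> sets borel" "B \<subseteq> \<phi> ` V"
    proof -
      have "B = \<phi> ` V \<inter> {x. 1 + \<eta> < \<delta>' x}" by (auto simp: B_def)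
      then show "B \<in> sets borel" using img meas by simp
    qed (auto simp: B_def)
    have le: "ennreal (1 + \<eta>) * indicator B x \<le> ennreal (\<delta>' x) * indicator B x" for x
      by (auto simp: B_def split: split_indicator intro!: ennreal_leI)
    have "AE x in Ah. ennreal (\<delta>' x) * indicator B x \<le> ennreal (1 + \<eta>) * indicator B x"
    proof (rule ccontr)
      assume "\<not> ?thesis"
      then have "(\<integral>\<^sup>+x. ennreal (1 + \<eta>) * indicator B x \<partial>Ah) < (\<integral>\<^sup>+x. ennreal (\<delta>' x) * indicator B x \<partial>Ah)"
        using constfin[OF B] le by (intro nn_integral_less meas_ind meas_h B(1)) auto
      also have "\<dots> \<le> (\<integral>\<^sup>+u\<in>{u \<in> V. \<phi> u \<in> B}. ennreal (1 + \<eta>) \<partial>lborel)"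
        unfolding key(3)[OF B] using \<psi>(2)
        by (intro nn_integral_mono) (force simp: J_def split: split_indicator intro!: ennreal_leI)
      also have "\<dots> = (\<integral>\<^sup>+x. ennreal (1 + \<eta>) * indicator B x \<partial>Ah)" by (rule const[OF B])
      finally show False by simp
    qed
    then show ?thesis
    proof (rule AE_mp, intro AE_I2 impI)
      fix x assume x: "ennreal (\<delta>' x) * indicator B x \<le> ennreal (1 + \<eta>) * indicator B x" "x \<in> \<phi> ` V"
      then have \<delta>x: "\<delta>' x = \<delta> x" "0 \<le> \<delta> x" using \<delta>(2) V(3) by (auto simp: \<delta>'_def)
      show "\<delta> x \<le> 1 + \<eta>"
      proof (rule ccontr)
        assume c: "\<not> \<delta> x \<le> 1 + \<eta>"
        then have "x \<in> B" using x \<delta>x by (auto simp: B_def)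
        then have "ennreal (\<delta> x) \<le> ennreal (1 + \<eta>)" using x \<delta>x by simp
        \<comment> \<open>\<open>ennreal\<close> truncates at 0, so the inequality can be read back
          in the reals once its right side is nonnegative; any parameter in \<open>V\<close> shows
          \<eta> \<ge> 0.\<close>
        moreover have "0 \<le> 1 + \<eta>" 
        proof -
          obtain u where "u \<in> V" using x by blast
          then show ?thesis using \<psi>(2)[of u] by linarith
        qed
        ultimately show False using c by (simp add: ennreal_le_iff)
      qed
    qed
  qed
  have lower: "AE x in Ah. x \<in> \<phi> ` V \<longrightarrow> 1 - \<eta> \<le> \<delta> x"
  proof -
    define B where "B = {x \<in> \<phi> ` V. \<delta>' x < 1 - \<eta>}"
    have B: "B \<in> sets borel" "B \<subseteq> \<phi> ` V"
    proof -
      have "B = \<phi> ` V \<inter> {x. \<delta>' x < 1 - \<eta>}" by (auto simp: B_def)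
      then show "B \<in> sets borel" using img meas by simp
    qed (auto simp: B_def)
    have le: "ennreal (\<delta>' x) * indicator B x \<le> ennreal (1 - \<eta>) * indicator B x" for x
      by (auto simp: B_def split: split_indicator intro!: ennreal_leI)
    have "AE x in Ah. ennreal (1 - \<eta>) * indicator B x \<le> ennreal (\<delta>' x) * indicator B x"
    proof (rule ccontr)
      assume n: "\<not> ?thesis"
      have "(\<integral>\<^sup>+x. ennreal (\<delta>' x) * indicator B x \<partial>Ah) \<le> (\<integral>\<^sup>+x. ennreal (1 - \<eta>) * indicator B x \<partial>Ah)"
        by (intro nn_integral_mono le)
      then have fin: "(\<integral>\<^sup>+x. ennreal (\<delta>' x) * indicator B x \<partial>Ah) \<noteq> \<infinity>"
        using constfin[OF B, of "1 - \<eta>"] by (auto simp: top_unique)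
      have "(\<integral>\<^sup>+x. ennreal (\<delta>' x) * indicator B x \<partial>Ah) < (\<integral>\<^sup>+x. ennreal (1 - \<eta>) * indicator B x \<partial>Ah)"
        using fin n le by (intro nn_integral_less meas_ind meas_h B(1)) auto
      also have "\<dots> = (\<integral>\<^sup>+u\<in>{u \<in> V. \<phi> u \<in> B}. ennreal (1 - \<eta>) \<partial>lborel)" by (rule const[OF B, symmetric])
      also have "\<dots> \<le> (\<integral>\<^sup>+u\<in>{u \<in> V. \<phi> u \<in> B}. ennreal (J u) \<partial>lborel)"
        using \<psi>(2) by (intro nn_integral_mono) (force simp: J_def split: split_indicator intro!: ennreal_leI)
      also have "\<dots> = (\<integral>\<^sup>+x. ennreal (\<delta>' x) * indicator B x \<partial>Ah)" by (rule key(3)[OF B, symmetric])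
      finally show False by simp
    qed
    then show ?thesis
    proof (rule AE_mp, intro AE_I2 impI)
      fix x assume x: "ennreal (1 - \<eta>) * indicator B x \<le> ennreal (\<delta>' x) * indicator B x" "x \<in> \<phi> ` V"
      then have \<delta>x: "\<delta>' x = \<delta> x" "0 \<le> \<delta> x" using \<delta>(2) V(3) by (auto simp: \<delta>'_def)
      show "1 - \<eta> \<le> \<delta> x"
      proof (rule ccontr)
        assume c: "\<not> 1 - \<eta> \<le> \<delta> x"
        then have "x \<in> B" using x \<delta>x by (auto simp: B_def)
        then have "ennreal (1 - \<eta>) \<le> ennreal (\<delta> x)" using x \<delta>x by simp
        then show False using c \<delta>x by (simp add: ennreal_le_iff)
      qed
    qed
  qed
  from upper lower show ?thesis by eventually_elim auto
qed

subsection \<open>The error estimates\<close>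

text \<open>\<open>norm\<close> on matrices is the Euclidean norm of the entries, not the operator
  norm. Bounding each entry by \<open>b\<close> and summing costs the number of entries, the 9 of
  \<open>R_op_bound\<close>.\<close>

lemma norm_matrix_le_of_vec:
  fixes M :: "real^'n^'m"
  assumes "\<And>v. norm (M *v v) \<le> b * norm v"
  shows "norm M \<le> real CARD('m) * real CARD('n) * b"
proof -
  have entry: "\<bar>M $ i $ j\<bar> \<le> b" for i j
  proof -
    have "\<bar>M $ i $ j\<bar> = \<bar>(M *v axis j 1) $ i\<bar>" by (simp add: matrix_vector_mult_basis column_def)
    also have "\<dots> \<le> norm (M *v axis j 1)" by (rule component_le_norm_cart)
    also have "\<dots> \<le> b" using assms[of "axis j 1"] by simp
    finally show ?thesis .
  qed
  have row: "norm (M $ i) \<le> real CARD('n) * b" for i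
  proof -
    have "norm (M $ i) \<le> (\<Sum>j\<in>UNIV. \<bar>M $ i $ j\<bar>)" by (rule norm_le_l1_cart)
    also have "\<dots> \<le> real CARD('n) * b" using sum_mono[of UNIV "\<lambda>j. \<bar>M $ i $ j\<bar>" "\<lambda>_. b"] entry by simp
    finally show ?thesis .
  qed
  have "norm M \<le> (\<Sum>i\<in>UNIV. norm (M $ i))" unfolding norm_vec_def by (rule L2_set_le_sum) simp
  also have "\<dots> \<le> real CARD('m) * (real CARD('n) * b)"
    using sum_mono[of UNIV "\<lambda>i. norm (M $ i)" "\<lambda>_. real CARD('n) * b"] row by simp
  finally show ?thesis by (simp add: mult.assoc)
qed

context fermi begin

text \<open>With w = P v the expression is w - (w + e) / \<delta>, where e = P Q P_h Q w - w. It
  splits into -((1 - \<delta>) / \<delta>) w and -e / \<delta>, and 1 / \<delta> \<le> 2 by the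
  assumption on \<delta>. The terms of \<open>e\<close> that contain the Weingarten map carry a
  factor d and add up to 6 \<kappa> \<bar>d\<bar>.\<close>

lemma R_op_bound:
  assumes x: "x \<in> U" and small: "\<kappa> * \<bar>sd x\<bar> \<le> 1/2"
    and n: "norm n = 1" and \<delta>: "\<bar>1 - \<delta> x\<bar> \<le> 1/2"
  shows "norm ((mat 1 - R_op \<Gamma> \<nu> \<delta> n x) ** tangent_proj (ext_normal \<Gamma> \<nu> x))
    \<le> 9 * (2 * \<bar>1 - \<delta> x\<bar> + 2 * (norm (tproj (\<nu> (foot x)) n))\<^sup>2 + 12 * \<kappa> * \<bar>sd x\<bar>)"
proof -
  define N where "N = \<nu> (foot x)"
  define \<tau> where "\<tau> = norm (tproj N n)"
  define s where "s = sd x"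
  define b where "b = 2 * \<bar>1 - \<delta> x\<bar> + 2 * \<tau>\<^sup>2 + 12 * \<kappa> * \<bar>s\<bar>"
  have N: "norm N = 1" using norm_normal[OF decomposition(1)[OF x]] by (simp add: N_def)
  define H where "H = Dnormal x"
  have Hw: "weingarten \<Gamma> \<nu> x *v v = H v" for v
    unfolding weingarten_def jacobian_def H_def
    using matrix_vector_mul(2)[OF has_derivative_linear[OF normal_has_Dnormal[OF x small]]] by (rule fun_cong)
  have Hn: "norm (s *\<^sub>R H v) \<le> 2 * \<kappa> * \<bar>s\<bar> * norm v" for v
    using mult_left_mono[OF norm_Dnormal_le'[OF x small, of v], of "\<bar>s\<bar>"] by (simp add: H_def mult_ac)
  have s1: "2 * \<kappa> * \<bar>s\<bar> \<le> 1" using small by (simp add: s_def)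
  have \<delta>pos: "1/2 \<le> \<delta> x" using \<delta> by linarith
  have "norm (((mat 1 - R_op \<Gamma> \<nu> \<delta> n x) ** tangent_proj (ext_normal \<Gamma> \<nu> x)) *v v) \<le> b * norm v" for v
  proof -
    define w where "w = tproj N v"
    define Q where "Q = (\<lambda>u. u - s *\<^sub>R H u)"
    have Q: "(mat 1 - sd x *\<^sub>R weingarten \<Gamma> \<nu> x) *v u = Q u" for u
      by (simp add: Q_def s_def matrix_vector_mult_diff_rdistrib scaleR_matrix_vector_assoc[symmetric] Hw)
    have R: "R_op \<Gamma> \<nu> \<delta> n x *v u = (1 / \<delta> x) *\<^sub>R tproj N (Q (tproj n (Q u)))" for u
      by (simp only: R_op_def Let_def scaleR_matrix_vector_assoc[symmetric] matrix_vector_mul_assoc[symmetric]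
          tangent_proj_vec Q ext_normal_def N_def[symmetric])
    define y where "y = tproj n (Q w)"
    define e where "e = tproj N (Q y) - w"
    have wv: "norm w \<le> norm v" unfolding w_def by (rule norm_tproj_le[OF N])
    have eval: "((mat 1 - R_op \<Gamma> \<nu> \<delta> n x) ** tangent_proj (ext_normal \<Gamma> \<nu> x)) *v v
        = w - (1 / \<delta> x) *\<^sub>R (w + e)"
      by (simp add: matrix_vector_mul_assoc[symmetric] tangent_proj_vec matrix_vector_mult_diff_rdistrib
          R ext_normal_def N_def[symmetric] w_def[symmetric] y_def[symmetric] e_def)
    have yw: "norm y \<le> 2 * norm w"
    proof -
      have "norm y \<le> norm (Q w)" unfolding y_def by (rule norm_tproj_le[OF n])
      also have "\<dots> \<le> norm w + norm (s *\<^sub>R H w)" unfolding Q_def by (rule norm_triangle_ineq4)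
      also have "\<dots> \<le> norm w + 1 * norm w"
        using Hn[of w] mult_right_mono[OF s1 norm_ge_zero[of w]] by linarith
      finally show ?thesis by simp
    qed
    have e_eq: "e = - ((n \<bullet> w) *\<^sub>R tproj N n) - tproj N (tproj n (s *\<^sub>R H w)) - tproj N (s *\<^sub>R H y)"
    proof -
      have Nw: "tproj N w = w" unfolding w_def by (rule tproj_id[OF tproj_orth[OF N]])
      have "tproj N (Q y) = tproj N y - tproj N (s *\<^sub>R H y)"
        unfolding Q_def by (rule linear_diff[OF linear_tproj])
      moreover have "y = tproj n w - tproj n (s *\<^sub>R H w)"
        unfolding y_def Q_def by (rule linear_diff[OF linear_tproj])
      moreover have "tproj N (tproj n w) = w - (n \<bullet> w) *\<^sub>R tproj N n"
        by (simp add: tproj_def[of n w] linear_diff[OF linear_tproj] linear_cmul[OF linear_tproj] Nw)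
      ultimately show ?thesis by (simp add: e_def linear_diff[OF linear_tproj])
    qed
    \<comment> \<open>P is symmetric, so n \<bullet> P v = P n \<bullet> v. This scalar is of size
      \<tau>, and its product with P n of size \<tau>^2.\<close>
    have nw: "\<bar>n \<bullet> w\<bar> \<le> \<tau> * norm v"
    proof -
      have "n \<bullet> w = tproj N n \<bullet> v"
        by (simp add: w_def tproj_def inner_diff_left inner_diff_right inner_commute[of n N])
      then show ?thesis using Cauchy_Schwarz_ineq2[of "tproj N n" v] by (simp add: \<tau>_def)
    qed
    have "norm e \<le> norm ((n \<bullet> w) *\<^sub>R tproj N n) + norm (tproj N (tproj n (s *\<^sub>R H w))) + norm (tproj N (s *\<^sub>R H y))"
      unfolding e_eq by (metis (no_types, opaque_lifting) add_right_mono norm_minus_cancel norm_triangle_ineq4 order_trans)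
    also have "\<dots> \<le> \<tau>\<^sup>2 * norm v + 2 * \<kappa> * \<bar>s\<bar> * norm v + 2 * \<kappa> * \<bar>s\<bar> * (2 * norm v)"
    proof (intro add_mono)
      show "norm ((n \<bullet> w) *\<^sub>R tproj N n) \<le> \<tau>\<^sup>2 * norm v"
        using mult_right_mono[OF nw, of \<tau>] by (simp add: \<tau>_def power2_eq_square mult_ac)
      have "norm (tproj N (tproj n (s *\<^sub>R H w))) \<le> norm (s *\<^sub>R H w)"
        using norm_tproj_le[OF N] norm_tproj_le[OF n] by (rule order_trans)
      also have "\<dots> \<le> 2 * \<kappa> * \<bar>s\<bar> * norm w" by (rule Hn)
      also have "\<dots> \<le> 2 * \<kappa> * \<bar>s\<bar> * norm v" using wv kappa_ge_1 by (intro mult_left_mono) auto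
      finally show "norm (tproj N (tproj n (s *\<^sub>R H w))) \<le> 2 * \<kappa> * \<bar>s\<bar> * norm v" .
      have "norm (tproj N (s *\<^sub>R H y)) \<le> norm (s *\<^sub>R H y)" by (rule norm_tproj_le[OF N])
      also have "\<dots> \<le> 2 * \<kappa> * \<bar>s\<bar> * norm y" by (rule Hn)
      also have "\<dots> \<le> 2 * \<kappa> * \<bar>s\<bar> * (2 * norm v)" using yw wv kappa_ge_1 by (intro mult_left_mono) (linarith, simp)
      finally show "norm (tproj N (s *\<^sub>R H y)) \<le> 2 * \<kappa> * \<bar>s\<bar> * (2 * norm v)" .
    qed
    finally have e: "norm e \<le> (\<tau>\<^sup>2 + 6 * \<kappa> * \<bar>s\<bar>) * norm v" by (simp add: algebra_simps)
    have inv: "0 < 1 / \<delta> x" "1 / \<delta> x \<le> 2" using \<delta>pos by (auto simp: field_simps)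
    have "w - (1 / \<delta> x) *\<^sub>R (w + e) = (- ((1 - \<delta> x) * (1 / \<delta> x))) *\<^sub>R w - (1 / \<delta> x) *\<^sub>R e"
    proof -
      have "- ((1 - \<delta> x) * (1 / \<delta> x)) = 1 - 1 / \<delta> x" using \<delta>pos by (simp add: field_simps)
      then show ?thesis by (simp only: scaleR_add_right scaleR_diff_left scaleR_one diff_diff_eq)
    qed
    then have "norm (w - (1 / \<delta> x) *\<^sub>R (w + e)) \<le> \<bar>1 - \<delta> x\<bar> * (1 / \<delta> x) * norm w + (1 / \<delta> x) * norm e"
      using norm_triangle_ineq4[of "(- ((1 - \<delta> x) * (1 / \<delta> x))) *\<^sub>R w" "(1 / \<delta> x) *\<^sub>R e"] inv(1)
      by (simp add: abs_mult)
    also have "\<dots> \<le> \<bar>1 - \<delta> x\<bar> * 2 * norm v + 2 * ((\<tau>\<^sup>2 + 6 * \<kappa> * \<bar>s\<bar>) * norm v)"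
      using inv wv e by (intro add_mono mult_mono) auto
    also have "\<dots> = b * norm v" by (simp add: b_def algebra_simps)
    finally show ?thesis unfolding eval .
  qed
  from norm_matrix_le_of_vec[OF this] show ?thesis
    unfolding b_def \<tau>_def s_def N_def by simp
qed

text \<open>The derivative of the projection is within 2 \<kappa> \<bar>d\<bar> of P on unit
  vectors. The 6 arises as 2 times 2 + 2, since one of the two errors in the cross product is
  multiplied by the bound 2 for \<open>Dfoot x e2\<close>.\<close>

lemma jacobian_bound:
  assumes x: "x \<in> U" and small: "\<kappa> * \<bar>sd x\<bar> \<le> 1/2"
    and e: "norm e1 = 1" "norm e2 = 1" "e1 \<bullet> e2 = 0"
  shows "\<bar>1 - norm (cross3 (Dfoot x e1) (Dfoot x e2))\<bar>
    \<le> 6 * \<kappa> * \<bar>sd x\<bar> + (\<nu> (foot x) \<bullet> e1)\<^sup>2 + (\<nu> (foot x) \<bullet> e2)\<^sup>2"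
proof -
  define N where "N = \<nu> (foot x)"
  have N: "norm N = 1" using norm_normal[OF decomposition(1)[OF x]] by (simp add: N_def)
  have diff: "norm (Dfoot x e - tproj N e) \<le> 2 * \<kappa> * \<bar>sd x\<bar>" if "norm e = 1" for e
    using norm_Dfoot_minus_tproj_le[OF x small, of e] that by (simp add: N_def)
  have "norm (cross3 (Dfoot x e1) (Dfoot x e2) - cross3 (tproj N e1) (tproj N e2))
    \<le> norm (Dfoot x e1 - tproj N e1) * norm (Dfoot x e2) + norm (tproj N e1) * norm (Dfoot x e2 - tproj N e2)"
    by (rule norm_cross3_diff_le)
  also have "\<dots> \<le> (2 * \<kappa> * \<bar>sd x\<bar>) * 2 + 1 * (2 * \<kappa> * \<bar>sd x\<bar>)"
    using diff[OF e(1)] diff[OF e(2)] norm_Dfoot_le[OF x small, of e2] norm_tproj_le[OF N, of e1] e kappa_ge_1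
    by (intro add_mono mult_mono) auto
  finally have 1: "norm (cross3 (Dfoot x e1) (Dfoot x e2) - cross3 (tproj N e1) (tproj N e2)) \<le> 6 * \<kappa> * \<bar>sd x\<bar>"
    by simp
  define J where "J = norm (cross3 (tproj N e1) (tproj N e2))"
  have sq: "J\<^sup>2 = 1 - (N \<bullet> e1)\<^sup>2 - (N \<bullet> e2)\<^sup>2"
    unfolding J_def by (rule norm_cross3_tproj[OF e N])
  have J: "0 \<le> J" by (simp add: J_def)
  have "J\<^sup>2 \<le> 1\<^sup>2" unfolding sq by simp
  then have J1: "J \<le> 1" by (rule power2_le_imp_le) simp
  \<comment> \<open>For J between 0 and 1 one has 1 - J \<le> 1 - J^2, which leaves the squares of
    the tilt without a square root.\<close>
  have "J\<^sup>2 \<le> J" using mult_right_mono[OF J1 J] by (simp add: power2_eq_square)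
  then have "\<bar>1 - J\<bar> \<le> (N \<bullet> e1)\<^sup>2 + (N \<bullet> e2)\<^sup>2" using sq J1 by linarith
  moreover have "\<bar>norm (cross3 (Dfoot x e1) (Dfoot x e2)) - J\<bar> \<le> 6 * \<kappa> * \<bar>sd x\<bar>"
    unfolding J_def by (rule order_trans[OF norm_triangle_ineq3 1])
  ultimately show ?thesis unfolding N_def[symmetric] by linarith
qed

text \<open>Cartesian coordinates make the inside of the element a patch with area element 1;
  composed with the projection they give a patch of \<Gamma>, controlled by
  \<open>jacobian_bound\<close>. The boundary consists of finitely many segments and is
  null.\<close>

lemma element_area_density:
  assumes vs: "simple_flat_polygon vs" "set vs \<subseteq> \<Gamma>" "poly_region vs \<subseteq> S" and S: "S \<subseteq> U" "inj_on foot S"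
    and small: "\<kappa> * diameter (poly_region vs) \<le> 1/2"
    and frame: "norm e1 = 1" "norm e2 = 1" "e1 \<bullet> e2 = 0" "c \<in> affine hull set vs"
      "affine hull set vs = range (\<lambda>(s, t). c + s *\<^sub>R e1 + t *\<^sub>R e2)"
    and \<eta>: "\<And>x. x \<in> poly_region vs \<Longrightarrow> 6 * \<kappa> * \<bar>sd x\<bar> + (\<nu> (foot x) \<bullet> e1)\<^sup>2 + (\<nu> (foot x) \<bullet> e2)\<^sup>2 \<le> \<eta>" "\<eta> < 1"
    and A: "surface_measure \<Gamma> A" and Ah: "surface_measure S Ah" and dens: "area_density foot S A Ah \<delta>"
  shows "AE x in Ah. x \<in> poly_region vs \<longrightarrow> \<bar>1 - \<delta> x\<bar> \<le> \<eta>"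
proof -
  define \<phi> where "\<phi> = (\<lambda>u :: real \<times> real. c + fst u *\<^sub>R e1 + snd u *\<^sub>R e2)"
  define V where "V = {u. \<phi> u \<in> poly_inside vs}"
  have aff: "affine hull set vs = range \<phi>" using frame(5) by (simp add: \<phi>_def case_prod_beta)
  have e: "e1 \<bullet> e1 = 1" "e2 \<bullet> e2 = 1" "e2 \<bullet> e1 = 0" using frame(1-3) by (auto simp: norm_eq_1 inner_commute)
  have img: "\<phi> ` V = poly_inside vs"
  proof -
    have "poly_inside vs \<subseteq> range \<phi>" using aff by (auto simp: poly_inside_iff)
    then show ?thesis unfolding V_def by blast
  qed
  have sub: "\<phi> u \<in> poly_region vs" if "u \<in> V" for u
    using that by (simp add: V_def poly_region_eq)
  have regU: "poly_region vs \<subseteq> U" using vs(3) S(1) by blast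
  have smallE: "\<kappa> * \<bar>sd x\<bar> \<le> 1/2" if "x \<in> poly_region vs" for x
    using element_small[OF vs(1,2) regU small that] .
  have der: "(\<phi> has_derivative (\<lambda>w. fst w *\<^sub>R e1 + snd w *\<^sub>R e2)) (at u)" for u
    unfolding \<phi>_def by (auto intro!: derivative_eq_intros)
  have cont: "continuous_on X \<phi>" for X unfolding \<phi>_def by (intro continuous_intros)
  have "open V"
    unfolding open_contains_ball
  proof
    fix u assume u: "u \<in> V"
    then have "\<phi> u \<in> poly_inside vs" by (simp add: V_def)
    then obtain r where r: "r > 0" "ball (\<phi> u) r \<inter> affine hull set vs \<subseteq> poly_inside vs"
      using poly_inside_open by blast
    have "open (\<phi> -` ball (\<phi> u) r)" using cont[of UNIV] by (simp add: open_vimage)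
    moreover have "u \<in> \<phi> -` ball (\<phi> u) r" using r by simp
    ultimately obtain d where "d > 0" "ball u d \<subseteq> \<phi> -` ball (\<phi> u) r" by (meson open_contains_ball)
    then show "\<exists>d>0. ball u d \<subseteq> V" using r aff by (auto simp: V_def subset_iff)
  qed
  have inv: "fst u = e1 \<bullet> (\<phi> u - c)" "snd u = e2 \<bullet> (\<phi> u - c)" for u
    using frame(3) e by (simp_all add: \<phi>_def inner_add_right)
  have "inj \<phi>" by (rule injI) (metis inv prod.expand)
  have "bounded V"
  proof -
    have "bounded ((\<lambda>x. e \<bullet> (x - c)) ` poly_region vs)" for e
    proof -
      have "bounded ((\<lambda>x. x - c) ` poly_region vs)"
        using bounded_translation_minus[OF bounded_poly_region] .
      from bounded_linear_image[OF this bounded_linear_inner_right[of e]] show ?thesis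
        by (simp add: image_image)
    qed
    then have "bounded (((\<lambda>x. e1 \<bullet> (x - c)) ` poly_region vs) \<times> ((\<lambda>x. e2 \<bullet> (x - c)) ` poly_region vs))"
      by (intro bounded_Times)
    moreover have "V \<subseteq> ((\<lambda>x. e1 \<bullet> (x - c)) ` poly_region vs) \<times> ((\<lambda>x. e2 \<bullet> (x - c)) ` poly_region vs)"
      using inv sub by (auto simp: image_iff) (metis fst_conv snd_conv)+
    ultimately show ?thesis by (rule bounded_subset)
  qed
  have cross1: "norm (cross3 e1 e2) = 1"
    using norm_cross[of e1 e2] frame(1-3) by (simp add: power2_eq_1_iff) (smt (verit) norm_ge_zero)
  have patch: "regular_patch S V \<phi> (\<lambda>_. e1) (\<lambda>_. e2)"
    unfolding regular_patch_def
    using \<open>open V\<close> \<open>inj \<phi>\<close> sub vs(3) der cross1 by (auto intro: inj_on_subset)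
  have J: "\<bar>1 - norm (cross3 (Dfoot x e1) (Dfoot x e2))\<bar> \<le> \<eta>" if x: "x \<in> poly_region vs" for x
    using jacobian_bound[OF _ smallE[OF x] frame(1-3)] \<eta>(1)[OF x] regU x by (meson order_trans subsetD)
  have patch2: "regular_patch \<Gamma> V (foot \<circ> \<phi>) (\<lambda>u. Dfoot (\<phi> u) e1) (\<lambda>u. Dfoot (\<phi> u) e2)"
    unfolding regular_patch_def
  proof (intro conjI ballI)
    show "open V" by fact
    show "inj_on (foot \<circ> \<phi>) V"
      using \<open>inj \<phi>\<close> S(2) sub vs(3) by (intro comp_inj_on inj_on_subset[OF \<open>inj \<phi>\<close>] inj_on_subset[OF S(2)]) auto
    show "(foot \<circ> \<phi>) ` V \<subseteq> \<Gamma>" using sub regU decomposition(1) by auto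
    have cD: "continuous_on (poly_region vs) (\<lambda>x. Dfoot x e)" for e
      using regU smallE by (rule continuous_on_Dfoot)
    have sub': "\<phi> ` V \<subseteq> poly_region vs" using sub by blast
    show "continuous_on V (\<lambda>u. Dfoot (\<phi> u) e1)" "continuous_on V (\<lambda>u. Dfoot (\<phi> u) e2)"
      by (rule continuous_on_compose2[OF cD cont sub'])+
    fix u assume u: "u \<in> V"
    have xU: "\<phi> u \<in> U" using sub[OF u] regU by blast
    have dfoot: "(foot has_derivative Dfoot (\<phi> u)) (at (\<phi> u))"
      by (rule foot_has_Dfoot[OF xU smallE[OF sub[OF u]]])
    have lin: "linear (Dfoot (\<phi> u))" using dfoot by (rule has_derivative_linear)
    show "(foot \<circ> \<phi> has_derivative (\<lambda>w. fst w *\<^sub>R Dfoot (\<phi> u) e1 + snd w *\<^sub>R Dfoot (\<phi> u) e2)) (at u)"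
      using has_derivative_compose[OF der dfoot]
      by (simp add: o_def linear_add[OF lin] linear_cmul[OF lin])
    \<comment> \<open>\<eta> < 1 enters here: the area element is at least 1 - \<eta>, so the
      projected patch is regular.\<close>
    show "cross3 (Dfoot (\<phi> u) e1) (Dfoot (\<phi> u) e2) \<noteq> 0"
      using J[OF sub[OF u]] \<eta>(2) by force
  qed
  have inside: "AE x in Ah. x \<in> \<phi> ` V \<longrightarrow> \<bar>1 - \<delta> x\<bar> \<le> \<eta>"
    using area_density_bound_on_patch[OF A Ah dens patch cross1 \<open>bounded V\<close> patch2] J sub by blast
  have "poly_boundary vs \<in> null_sets Ah"
    unfolding poly_boundary_def poly_edge_def
    by (intro null_sets.finite_UN surface_measure_segment_null[OF Ah]) simp_all
  then have "AE x in Ah. x \<notin> poly_boundary vs" by (rule AE_not_in)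
  with inside show ?thesis
    unfolding img by eventually_elim (auto simp: poly_region_eq)
qed

end

section \<open>Choice of the constants and assembly over the elements\<close>

theorem lemma2:
  fixes K \<gamma>1 \<gamma>2 :: real
  assumes "0 < \<gamma>1" and "0 < \<gamma>2"
  shows "\<exists>C>0. \<exists>h0>0. \<forall>\<Gamma> \<nu> U h T.
    oriented_C2_surface \<Gamma> \<nu> \<and> curvature_bounded \<Gamma> \<nu> K \<and> fermi_stripe \<Gamma> \<nu> U \<and> 0 < h \<and>
    polygonal_approximation \<Gamma> \<nu> U \<gamma>1 \<gamma>2 h T \<longrightarrow>
      (\<forall>vs\<in>T. \<forall>x\<in>poly_region vs. \<bar>oriented_dist \<Gamma> \<nu> x\<bar> \<le> C * h\<^sup>2) \<and>
      (\<forall>A A\<^sub>h \<delta> \<nu>\<^sub>h.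
         h \<le> h0 \<and> surface_measure \<Gamma> A \<and> surface_measure (mesh_surface T) A\<^sub>h \<and>
         area_density (fermi_proj \<Gamma> \<nu>) (mesh_surface T) A A\<^sub>h \<delta> \<and>
         (\<forall>vs\<in>T. flat_unit_normal vs (\<nu>\<^sub>h vs)) \<longrightarrow>
           (AE x in A\<^sub>h. x \<in> mesh_surface T \<longrightarrow> \<bar>1 - \<delta> x\<bar> \<le> C * h\<^sup>2) \<and>
           (\<forall>vs\<in>T. AE x in A\<^sub>h. x \<in> poly_region vs \<longrightarrow>
              norm ((mat 1 - R_op \<Gamma> \<nu> \<delta> (\<nu>\<^sub>h vs) x) ** tangent_proj (ext_normal \<Gamma> \<nu> x))
                \<le> C * h\<^sup>2))"
proof -
  \<comment> \<open>A curvature bound of at least 1 covers nonpositive \<open>K\<close> and allows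
    \<kappa> to be absorbed into \<kappa>^2.\<close>
  define \<kappa> where "\<kappa> = max K 1"
  \<comment> \<open>\<open>B * h\<close> bounds the tilt. In \<open>C2\<close>, 24 \<kappa>^2 is 6
    \<kappa> times the 4 \<kappa> of the distance bound, and 2 B^2 comes from the two frame vectors.
    \<open>C\<close> is \<open>R_op_bound\<close> with C2, 2 B^2 and 4 \<kappa> inserted for the
    density, the squared tilt and the distance.\<close>
  define B where "B = \<kappa> * (16 / \<gamma>1 + \<gamma>1 + 2)"
  define C2 where "C2 = 24 * \<kappa>\<^sup>2 + 2 * B\<^sup>2"
  define C where "C = 9 * (2 * C2 + 4 * B\<^sup>2 + 48 * \<kappa>\<^sup>2)"
  define h0 where "h0 = 1 / (2 * C2)"
  have \<kappa>: "\<kappa> \<ge> 1" "K \<le> \<kappa>" by (auto simp: \<kappa>_def)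
  have \<kappa>2: "\<kappa> \<le> \<kappa>\<^sup>2" using mult_left_mono[OF \<kappa>(1), of \<kappa>] \<kappa>(1) by (simp add: power2_eq_square)
  have B0: "B\<^sup>2 \<ge> 0" by simp
  have C2: "C2 \<ge> 24" "\<kappa> \<le> C2" using \<kappa> \<kappa>2 B0 unfolding C2_def by linarith+
  have "C = 18 * C2 + 36 * B\<^sup>2 + 432 * \<kappa>\<^sup>2" by (simp add: C_def)
  then have C: "C > 0" "4 * \<kappa> \<le> C" "C2 \<le> C" using C2 \<kappa>(1) \<kappa>2 B0 by linarith+
  have h0: "h0 > 0" using C2 by (simp add: h0_def)
  have main: "(\<forall>vs\<in>T. \<forall>x\<in>poly_region vs. \<bar>oriented_dist \<Gamma> \<nu> x\<bar> \<le> C * h\<^sup>2) \<and>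
      (\<forall>A A\<^sub>h \<delta> \<nu>\<^sub>h.
         h \<le> h0 \<and> surface_measure \<Gamma> A \<and> surface_measure (mesh_surface T) A\<^sub>h \<and>
         area_density (fermi_proj \<Gamma> \<nu>) (mesh_surface T) A A\<^sub>h \<delta> \<and>
         (\<forall>vs\<in>T. flat_unit_normal vs (\<nu>\<^sub>h vs)) \<longrightarrow>
           (AE x in A\<^sub>h. x \<in> mesh_surface T \<longrightarrow> \<bar>1 - \<delta> x\<bar> \<le> C * h\<^sup>2) \<and>
           (\<forall>vs\<in>T. AE x in A\<^sub>h. x \<in> poly_region vs \<longrightarrow>
              norm ((mat 1 - R_op \<Gamma> \<nu> \<delta> (\<nu>\<^sub>h vs) x) ** tangent_proj (ext_normal \<Gamma> \<nu> x))
                \<le> C * h\<^sup>2))"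
    if surf: "oriented_C2_surface \<Gamma> \<nu>" and curv: "curvature_bounded \<Gamma> \<nu> K"
      and stripe: "fermi_stripe \<Gamma> \<nu> U" and h: "0 < h" and poly: "polygonal_approximation \<Gamma> \<nu> U \<gamma>1 \<gamma>2 h T"
    for \<Gamma> \<nu> U h T
  proof -
    interpret fermi \<Gamma> \<nu> U \<kappa>
    proof
      show "\<exists>S. (\<nu> has_derivative S) (at p within \<Gamma>) \<and> onorm S \<le> \<kappa>" if "p \<in> \<Gamma>" for p
        using curv that \<kappa>(2) unfolding curvature_bounded_def by (meson order_trans)
    qed (fact surf stripe \<kappa>(1))+
    let ?S = "mesh_surface T"
    have T: "finite T" "?S \<subseteq> U" "inj_on foot ?S"
      using poly by (auto simp: polygonal_approximation_def bij_betw_def)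
    have el: "simple_flat_polygon vs" "set vs \<subseteq> \<Gamma>" "diameter (poly_region vs) \<le> h"
      "\<exists>c \<rho>. star_shaped_wrt_disc vs c \<rho> \<and> \<gamma>1 * diameter (poly_region vs) \<le> \<rho>" if "vs \<in> T" for vs
    proof -
      have "\<forall>vs\<in>T. simple_flat_polygon vs \<and> set vs \<subseteq> \<Gamma> \<and> diameter (poly_region vs) \<le> h"
        using poly unfolding polygonal_approximation_def by (elim conjE)
      moreover have "\<forall>vs\<in>T. \<exists>c \<rho>. star_shaped_wrt_disc vs c \<rho> \<and> \<gamma>1 * diameter (poly_region vs) \<le> \<rho>"
        using poly unfolding polygonal_approximation_def by (elim conjE)
      ultimately show "simple_flat_polygon vs" "set vs \<subseteq> \<Gamma>" "diameter (poly_region vs) \<le> h"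
        "\<exists>c \<rho>. star_shaped_wrt_disc vs c \<rho> \<and> \<gamma>1 * diameter (poly_region vs) \<le> \<rho>"
        using that by simp_all
    qed
    have regS: "poly_region vs \<subseteq> ?S" if "vs \<in> T" for vs
      using that by (auto simp: mesh_surface_def)
    have regU: "poly_region vs \<subseteq> U" if "vs \<in> T" for vs using regS[OF that] T(2) by blast
    have dia: "0 \<le> diameter (poly_region vs)" for vs by (rule diameter_ge_0[OF bounded_poly_region])
    have sd4: "\<bar>sd x\<bar> \<le> 4 * \<kappa> * h\<^sup>2" if vs: "vs \<in> T" and x: "x \<in> poly_region vs" for vs x
    proof (cases "\<kappa> * h \<le> 1/2")
      case True
      then have "\<kappa> * diameter (poly_region vs) \<le> 1/2"
        using mult_left_mono[OF el(3)[OF vs], of \<kappa>] \<kappa>(1) by linarith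
      then have "\<bar>sd x\<bar> \<le> 4 * \<kappa> * (diameter (poly_region vs))\<^sup>2"
        using element_sd_bound[OF el(1,2)[OF vs] regU[OF vs] _ x] by blast
      also have "\<dots> \<le> 4 * \<kappa> * h\<^sup>2"
        using el(3)[OF vs] dia \<kappa>(1) by (intro mult_left_mono power_mono) auto
      finally show ?thesis .
    next
      case False
      \<comment> \<open>On coarse meshes the first-order bound suffices, because \<kappa> h > 1/2
        puts h below 4 \<kappa> h^2; so (i) holds for every h.\<close>
      have "\<bar>sd x\<bar> \<le> h"
        using element_sd_le_diameter[OF el(1,2)[OF vs] regU[OF vs] x] el(3)[OF vs] by linarith
      also have "\<dots> \<le> (4 * (\<kappa> * h)) * h" using False h by simp
      finally show ?thesis by (simp add: power2_eq_square mult_ac)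
    qed
    have part1: "\<bar>sd x\<bar> \<le> C * h\<^sup>2" if "vs \<in> T" "x \<in> poly_region vs" for vs x
      using sd4[OF that] mult_right_mono[OF C(2), of "h\<^sup>2"] by simp
    have rest: "(AE x in A\<^sub>h. x \<in> ?S \<longrightarrow> \<bar>1 - \<delta> x\<bar> \<le> C * h\<^sup>2) \<and>
           (\<forall>vs\<in>T. AE x in A\<^sub>h. x \<in> poly_region vs \<longrightarrow>
              norm ((mat 1 - R_op \<Gamma> \<nu> \<delta> (\<nu>\<^sub>h vs) x) ** tangent_proj (ext_normal \<Gamma> \<nu> x)) \<le> C * h\<^sup>2)"
      if hh0: "h \<le> h0" and A: "surface_measure \<Gamma> A" and Ah: "surface_measure ?S A\<^sub>h"
        and dens: "area_density foot ?S A A\<^sub>h \<delta>"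
        and normal: "\<forall>vs\<in>T. flat_unit_normal vs (\<nu>\<^sub>h vs)" for A A\<^sub>h \<delta> \<nu>\<^sub>h
    proof -
      \<comment> \<open>All smallness comes from \<open>h0\<close>: as \<open>C2\<close> dominates
        \<kappa>, it gives \<kappa> h \<le> 1/2 for the projection, and C2 h^2 \<le> 1/2 keeps
        \<delta> away from 0 and the projected patches regular.\<close>
      have C2h: "C2 * h \<le> 1/2" using hh0 C2 by (simp add: h0_def field_simps)
      have \<kappa>h: "\<kappa> * h \<le> 1/2" using mult_right_mono[OF C2(2), of h] h C2h by linarith
      have "h \<le> 1" using mult_right_mono[OF C2(1), of h] C2h h by linarith
      then have "C2 * h\<^sup>2 \<le> C2 * h" using h C2(1) by (intro mult_left_mono) (auto simp: power2_eq_square)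
      then have C2h2: "C2 * h\<^sup>2 \<le> 1/2" using C2h by linarith
      have small: "\<kappa> * diameter (poly_region vs) \<le> 1/2" if "vs \<in> T" for vs
        using mult_left_mono[OF el(3)[OF that], of \<kappa>] \<kappa>(1) \<kappa>h by linarith
      have element: "AE x in A\<^sub>h. x \<in> poly_region vs \<longrightarrow> \<bar>1 - \<delta> x\<bar> \<le> C2 * h\<^sup>2 \<and>
          norm ((mat 1 - R_op \<Gamma> \<nu> \<delta> (\<nu>\<^sub>h vs) x) ** tangent_proj (ext_normal \<Gamma> \<nu> x)) \<le> C * h\<^sup>2"
        if vs: "vs \<in> T" for vs
      proof -
        obtain c \<rho> where star: "star_shaped_wrt_disc vs c \<rho>" "\<gamma>1 * diameter (poly_region vs) \<le> \<rho>"
          using el(4)[OF vs] by blast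
        have c: "c \<in> affine hull set vs" using star(1) by (simp add: star_shaped_wrt_disc_def)
        obtain e1 e2 where e: "norm e1 = 1" "norm e2 = 1" "e1 \<bullet> e2 = 0"
          and frame: "affine hull set vs = range (\<lambda>(s, t). c + s *\<^sub>R e1 + t *\<^sub>R e2)"
          using plane_frame[OF el(1)[OF vs]] c by metis
        have "(\<lambda>(s, t). c + s *\<^sub>R e1 + t *\<^sub>R e2) (t, 0) \<in> affine hull set vs"
          "(\<lambda>(s, t). c + s *\<^sub>R e1 + t *\<^sub>R e2) (0, t) \<in> affine hull set vs" for t
          unfolding frame by (rule rangeI)+
        then have line: "c + t *\<^sub>R e1 \<in> affine hull set vs" "c + t *\<^sub>R e2 \<in> affine hull set vs" for t
          by simp_all
        have tilt: "(\<nu> (foot x) \<bullet> e)\<^sup>2 \<le> B\<^sup>2 * h\<^sup>2"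
          if x: "x \<in> poly_region vs" and e: "norm e = 1" "\<And>t. c + t *\<^sub>R e \<in> affine hull set vs" for x e
        proof -
          have "\<bar>\<nu> (foot x) \<bullet> e\<bar> \<le> B * diameter (poly_region vs)"
            unfolding B_def
            by (rule element_normal_tilt[OF el(1,2)[OF vs] regU[OF vs] small[OF vs] star assms(1) e x])
          also have "\<dots> \<le> B * h"
            using el(3)[OF vs] \<kappa>(1) assms(1) by (intro mult_left_mono) (auto simp: B_def)
          finally have "\<bar>\<nu> (foot x) \<bullet> e\<bar>\<^sup>2 \<le> (B * h)\<^sup>2" by (intro power_mono) auto
          then show ?thesis by (simp add: power_mult_distrib)
        qed
        have sum: "6 * \<kappa> * \<bar>sd x\<bar> + (\<nu> (foot x) \<bullet> e1)\<^sup>2 + (\<nu> (foot x) \<bullet> e2)\<^sup>2 \<le> C2 * h\<^sup>2"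
          if x: "x \<in> poly_region vs" for x
        proof -
          have "6 * \<kappa> * \<bar>sd x\<bar> \<le> 6 * \<kappa> * (4 * \<kappa> * h\<^sup>2)"
            using sd4[OF vs x] \<kappa>(1) by (intro mult_left_mono) auto
          also have "\<dots> = 24 * \<kappa>\<^sup>2 * h\<^sup>2" by (simp add: power2_eq_square)
          finally show ?thesis
            using tilt[OF x e(1) line(1)] tilt[OF x e(2) line(2)]
            unfolding C2_def by (simp add: distrib_right)
        qed
        have dens_bound: "AE x in A\<^sub>h. x \<in> poly_region vs \<longrightarrow> \<bar>1 - \<delta> x\<bar> \<le> C2 * h\<^sup>2"
          using C2h2 sum
          by (intro element_area_density[OF el(1,2)[OF vs] regS[OF vs] T(2,3) small[OF vs] e c frame _ _ A Ah dens]) auto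
        define n where "n = \<nu>\<^sub>h vs"
        have n: "norm n = 1" "\<And>x y. x \<in> affine hull set vs \<Longrightarrow> y \<in> affine hull set vs \<Longrightarrow> n \<bullet> (x - y) = 0"
          using normal vs by (auto simp: flat_unit_normal_def n_def)
        have ne: "n \<bullet> e1 = 0" "n \<bullet> e2 = 0" using n(2)[OF line(1)[of 1] c] n(2)[OF line(2)[of 1] c] by simp_all
        have point: "norm ((mat 1 - R_op \<Gamma> \<nu> \<delta> n x) ** tangent_proj (ext_normal \<Gamma> \<nu> x)) \<le> C * h\<^sup>2"
          if x: "x \<in> poly_region vs" and \<delta>x: "\<bar>1 - \<delta> x\<bar> \<le> C2 * h\<^sup>2" for x
        proof -
          have xU: "x \<in> U" using regU[OF vs] x by blast
          have N: "norm (\<nu> (foot x)) = 1" using norm_normal[OF decomposition(1)[OF xU]] .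
          have "(norm (tproj (\<nu> (foot x)) n))\<^sup>2 = (\<nu> (foot x) \<bullet> e1)\<^sup>2 + (\<nu> (foot x) \<bullet> e2)\<^sup>2"
            using orthonormal_parseval[OF e n(1) ne, of "\<nu> (foot x)"] norm_tproj_square[OF N n(1)] N by simp
          then have \<tau>: "(norm (tproj (\<nu> (foot x)) n))\<^sup>2 \<le> 2 * (B\<^sup>2 * h\<^sup>2)"
            using tilt[OF x e(1) line(1)] tilt[OF x e(2) line(2)] by linarith
          have "\<kappa> * \<bar>sd x\<bar> \<le> \<kappa> * (4 * \<kappa> * h\<^sup>2)"
            using sd4[OF vs x] \<kappa>(1) by (intro mult_left_mono) auto
          moreover have "12 * \<kappa> * \<bar>sd x\<bar> = 12 * (\<kappa> * \<bar>sd x\<bar>)" by simp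
          ultimately have s: "12 * \<kappa> * \<bar>sd x\<bar> \<le> 12 * (\<kappa> * (4 * \<kappa> * h\<^sup>2))" by linarith
          have "norm ((mat 1 - R_op \<Gamma> \<nu> \<delta> n x) ** tangent_proj (ext_normal \<Gamma> \<nu> x))
            \<le> 9 * (2 * \<bar>1 - \<delta> x\<bar> + 2 * (norm (tproj (\<nu> (foot x)) n))\<^sup>2 + 12 * \<kappa> * \<bar>sd x\<bar>)"
            using \<delta>x C2h2
            by (intro R_op_bound[OF xU element_small[OF el(1,2)[OF vs] regU[OF vs] small[OF vs] x] n(1)]) linarith
          also have "\<dots> \<le> 9 * (2 * (C2 * h\<^sup>2) + 2 * (2 * (B\<^sup>2 * h\<^sup>2)) + 12 * (\<kappa> * (4 * \<kappa> * h\<^sup>2)))"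
            by (intro mult_left_mono add_mono) (use \<delta>x \<tau> s in auto)
          also have "\<dots> = C * h\<^sup>2" by (simp add: C_def power2_eq_square algebra_simps)
          finally show ?thesis .
        qed
        from dens_bound show ?thesis
          unfolding n_def[symmetric] by eventually_elim (use point in blast)
      qed
      have "AE x in A\<^sub>h. \<forall>vs\<in>T. x \<in> poly_region vs \<longrightarrow> \<bar>1 - \<delta> x\<bar> \<le> C2 * h\<^sup>2"
      proof (rule AE_finite_allI[OF T(1)])
        fix vs assume "vs \<in> T"
        from element[OF this] show "AE x in A\<^sub>h. x \<in> poly_region vs \<longrightarrow> \<bar>1 - \<delta> x\<bar> \<le> C2 * h\<^sup>2"
          by eventually_elim blast
      qed
      then have "AE x in A\<^sub>h. x \<in> ?S \<longrightarrow> \<bar>1 - \<delta> x\<bar> \<le> C * h\<^sup>2"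
      proof eventually_elim
        case (elim x)
        have "C2 * h\<^sup>2 \<le> C * h\<^sup>2" using C(3) by (intro mult_right_mono) auto
        then show ?case using elim unfolding mesh_surface_def by fastforce
      qed
      moreover have "AE x in A\<^sub>h. x \<in> poly_region vs \<longrightarrow>
          norm ((mat 1 - R_op \<Gamma> \<nu> \<delta> (\<nu>\<^sub>h vs) x) ** tangent_proj (ext_normal \<Gamma> \<nu> x)) \<le> C * h\<^sup>2"
        if "vs \<in> T" for vs
        using element[OF that] by eventually_elim blast
      ultimately show ?thesis by blast
    qed
    show ?thesis
    proof (intro conjI allI impI)
      show "\<forall>vs\<in>T. \<forall>x\<in>poly_region vs. \<bar>sd x\<bar> \<le> C * h\<^sup>2" using part1 by blast
    qed (use rest in blast)+
  qed
  show ?thesis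
    by (rule exI[of _ C], rule conjI[OF C(1)], rule exI[of _ h0], rule conjI[OF h0],
        intro allI impI, elim conjE, rule main)
qed

end
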